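(* Let $S$ be a semibounded relation in $\mathfrak H$ with lower bound $\gamma\in\mathbb R$ and let $c\le\gamma$. For a relation $H$ in $\mathfrak H$ the following are equivalent: (i) $H$ is a semibounded selfadjoint extension of $S$ which is bounded below by $c$ and satisfies $\mathfrak t_{S_{\rm F}}\subset\mathfrak t_H\subset\mathfrak t_{S_{{\rm K},c}}$; (ii) $H$ is a semibounded selfadjoint extension of $S$ which is extremal with respect to $c$.
   Context: Linear relations in $\mathfrak H$ are linear subspaces of $\mathfrak H\times\mathfrak H$; $T^*$ adjoint, $T^{**}$ closure, products $RT=\{\{f,h\}:\exists g,\{f,g\}\in T,\{g,h\}\in R\}$, $c+T=\{\{f,g+cf\}:\{f,g\}\in T\}$. $S$ semibounded with lower bound $\gamma$: $\gamma$ is the supremum of $c$ with $(\varphi',\varphi)\ge c\|\varphi\|^2$ on $S$; $\mathfrak t(S)[\varphi,\psi]=(\varphi',\psi)$ on $\mathrm{dom}\,S$. A representing map for $\mathfrak t(S)-c$ is a linear operator $Q_c$ into a Hilbert space with $\mathrm{dom}\,Q_c=\mathrm{dom}\,S$ and $\mathfrak t(S)[\varphi,\psi]=c(\varphi,\psi)+(Q_c\varphi,Q_c\psi)$; companion relation $J_c=\{\{Q_c\varphi,\varphi'-c\varphi\}:\{\varphi,\varphi'\}\in S\}$. Friedrichs extension $S_{\rm F}=c+Q_c^*Q_c^{**}$; Kreĭn type extension $S_{{\rm K},c}=c+J_c^{**}J_c^*$. For semibounded selfadjoint $H$, $\mathfrak t_H$ is its associated closed form (closure of $\mathfrak t(H)[\varphi,\psi]=(\varphi',\psi)$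 on $\mathrm{dom}\,H$); $\mathfrak t_1\subset\mathfrak t_2$ means extension. A selfadjoint extension $H$ of $S$ is extremal with respect to $c$ if for every $\{f,f'\}\in H$, $\inf\{(f'-h'-c(f-h),f-h):\{h,h'\}\in S\}=0$. *)

theory Defs
  imports "HOL-Analysis.Analysis" "HOL-Library.Extended_Real"
begin

class complex_vector = real_vector +
  fixes scaleC :: "complex \<Rightarrow> 'a \<Rightarrow> 'a"  (infixr \<open>*\<^sub>C\<close> 75)
  assumes scaleC_add_right: "a *\<^sub>C (x + y) = a *\<^sub>C x + a *\<^sub>C y"
    and scaleC_add_left: "(a + b) *\<^sub>C x = a *\<^sub>C x + b *\<^sub>C x"
    and scaleC_scaleC: "a *\<^sub>C (b *\<^sub>C x) = (a * b) *\<^sub>C x"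
    and scaleC_one: "1 *\<^sub>C x = x"
    and scaleR_scaleC: "r *\<^sub>R x = complex_of_real r *\<^sub>C x"

class complex_inner = complex_vector + real_normed_vector +
  fixes cinner :: "'a \<Rightarrow> 'a \<Rightarrow> complex"
  assumes cinner_commute: "cinner x y = cnj (cinner y x)"
    and cinner_add_left: "cinner (x + y) z = cinner x z + cinner y z"
    and cinner_scaleC_left: "cinner (a *\<^sub>C x) y = a * cinner x y"
    and cinner_self_real: "cinner x x \<in> \<real>"
    and cinner_ge_zero: "0 \<le> Re (cinner x x)"
    and cinner_eq_zero_iff: "cinner x x = 0 \<longleftrightarrow> x = 0"
    and norm_eq_sqrt_cinner: "norm x = sqrt (Re (cinner x x))"

class chilbert_space = complex_inner + complete_space

definition lin_rel :: "('a::complex_vector \<times> 'b::complex_vector) set \<Rightarrow> bool" where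
  "lin_rel T \<longleftrightarrow> (0, 0) \<in> T \<and>
     (\<forall>f g h k. (f, g) \<in> T \<longrightarrow> (h, k) \<in> T \<longrightarrow> (f + h, g + k) \<in> T) \<and>
     (\<forall>a f g. (f, g) \<in> T \<longrightarrow> (a *\<^sub>C f, a *\<^sub>C g) \<in> T)"

definition adj :: "('a::complex_inner \<times> 'b::complex_inner) set \<Rightarrow> ('b \<times> 'a) set" where
  "adj T = {(h, k). \<forall>f g. (f, g) \<in> T \<longrightarrow> cinner g h = cinner f k}"

definition relprod :: "('b \<times> 'c) set \<Rightarrow> ('a \<times> 'b) set \<Rightarrow> ('a \<times> 'c) set" where
  "relprod R T = {(f, h). \<exists>g. (f, g) \<in> T \<and> (g, h) \<in> R}"

definition shift :: "real \<Rightarrow> ('a::real_vector \<times> 'a) set \<Rightarrow> ('a \<times> 'a) set" where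
  "shift c T = {(f, g + c *\<^sub>R f) | f g. (f, g) \<in> T}"

definition selfadjoint :: "('a::complex_inner \<times> 'a) set \<Rightarrow> bool" where
  "selfadjoint H \<longleftrightarrow> H = adj H"

definition bounded_below_by :: "('a::complex_inner \<times> 'a) set \<Rightarrow> real \<Rightarrow> bool" where
  "bounded_below_by S c \<longleftrightarrow>
     (\<forall>\<phi> \<phi>'. (\<phi>, \<phi>') \<in> S \<longrightarrow> cinner \<phi>' \<phi> \<in> \<real> \<and> c * (norm \<phi>)\<^sup>2 \<le> Re (cinner \<phi>' \<phi>))"

definition semibounded :: "('a::complex_inner \<times> 'a) set \<Rightarrow> bool" where
  "semibounded S \<longleftrightarrow> (\<exists>c. bounded_below_by S c)"

definition has_lower_bound :: "('a::complex_inner \<times> 'a) set \<Rightarrow> real \<Rightarrow> bool" where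
  "has_lower_bound S \<gamma> \<longleftrightarrow> semibounded S \<and> Sup (ereal ` {c. bounded_below_by S c}) = ereal \<gamma>"

text \<open>A form is a pair (domain, sesquilinear function).\<close>
type_synonym 'a form = "'a set \<times> ('a \<Rightarrow> 'a \<Rightarrow> complex)"

definition form_ext :: "'a form \<Rightarrow> 'a form \<Rightarrow> bool" where
  "form_ext t1 t2 \<longleftrightarrow> fst t1 \<subseteq> fst t2 \<and> (\<forall>x\<in>fst t1. \<forall>y\<in>fst t1. snd t1 x y = snd t2 x y)"

definition form_of :: "('a::complex_inner \<times> 'a) set \<Rightarrow> 'a form" where
  "form_of S = (Domain S, \<lambda>\<phi> \<psi>. cinner (SOME \<phi>'. (\<phi>, \<phi>') \<in> S) \<psi>)"

definition form_conv :: "'a::complex_inner form \<Rightarrow> (nat \<Rightarrow> 'a) \<Rightarrow> 'a \<Rightarrow> bool" where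
  "form_conv t x \<phi> \<longleftrightarrow> (\<forall>n. x n \<in> fst t) \<and> x \<longlonglongrightarrow> \<phi> \<and>
     (\<forall>e>0. \<exists>N. \<forall>n\<ge>N. \<forall>m\<ge>N. cmod (snd t (x n - x m) (x n - x m)) < e)"

definition form_closure :: "'a::complex_inner form \<Rightarrow> 'a form" where
  "form_closure t = ({\<phi>. \<exists>x. form_conv t x \<phi>},
     \<lambda>\<phi> \<psi>. THE v. \<forall>x y. form_conv t x \<phi> \<longrightarrow> form_conv t y \<psi> \<longrightarrow>
                      (\<lambda>n. snd t (x n) (y n)) \<longlonglongrightarrow> v)"

definition closed_form :: "('a::complex_inner \<times> 'a) set \<Rightarrow> 'a form" where
  "closed_form H = form_closure (form_of H)"

definition representing_map :: "('a::complex_inner \<times> 'a) set \<Rightarrow> real \<Rightarrow> ('a \<Rightarrow> 'b::complex_inner) \<Rightarrow> bool" where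
  "representing_map S c Q \<longleftrightarrow>
     (\<forall>x\<in>Domain S. \<forall>y\<in>Domain S. Q (x + y) = Q x + Q y) \<and>
     (\<forall>x\<in>Domain S. \<forall>a. Q (a *\<^sub>C x) = a *\<^sub>C Q x) \<and>
     (\<forall>\<phi> \<phi>' \<psi>. (\<phi>, \<phi>') \<in> S \<longrightarrow> \<psi> \<in> Domain S \<longrightarrow>
        cinner \<phi>' \<psi> = complex_of_real c * cinner \<phi> \<psi> + cinner (Q \<phi>) (Q \<psi>))"

definition rep_graph :: "('a \<times> 'a) set \<Rightarrow> ('a \<Rightarrow> 'b) \<Rightarrow> ('a \<times> 'b) set" where
  "rep_graph S Q = {(\<phi>, Q \<phi>) | \<phi>. \<phi> \<in> Domain S}"

definition companion :: "('a::real_vector \<times> 'a) set \<Rightarrow> real \<Rightarrow> ('a \<Rightarrow> 'b) \<Rightarrow> ('b \<times> 'a) set" where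
  "companion S c Q = {(Q \<phi>, \<phi>' - c *\<^sub>R \<phi>) | \<phi> \<phi>'. (\<phi>, \<phi>') \<in> S}"

definition friedrichs :: "('a::complex_inner \<times> 'a) set \<Rightarrow> real \<Rightarrow> ('a \<Rightarrow> 'b::complex_inner) \<Rightarrow> ('a \<times> 'a) set" where
  "friedrichs S c Q = shift c (relprod (adj (rep_graph S Q)) (adj (adj (rep_graph S Q))))"

definition krein :: "('a::complex_inner \<times> 'a) set \<Rightarrow> real \<Rightarrow> ('a \<Rightarrow> 'b::complex_inner) \<Rightarrow> ('a \<times> 'a) set" where
  "krein S c Q = shift c (relprod (adj (adj (companion S c Q))) (adj (companion S c Q)))"

definition extremal :: "('a::complex_inner \<times> 'a) set \<Rightarrow> ('a \<times> 'a) set \<Rightarrow> real \<Rightarrow> bool" where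
  "extremal S H c \<longleftrightarrow> (\<forall>f f'. (f, f') \<in> H \<longrightarrow>
     Inf ((\<lambda>(h, h'). ereal (Re (cinner (f' - h' - c *\<^sub>R (f - h)) (f - h)))) ` S) = 0)"

end

theory Submission
  imports Defs
begin

text \<open>
  On a symmetric extension \<open>H\<close> of \<open>S\<close> bounded below by \<open>c\<close>, the form \<open>(f' - c f, g)\<close> is a semi-inner product,
  called the energy below, and extremality says that \<open>S\<close> is dense in \<open>H\<close> for its seminorm. On \<open>S\<close> the
  energy is \<open>(Q f, Q g)\<close>. The form of the Krein extension is represented by the operator part of \<open>J\<^sup>*\<close>,
  because the domain of \<open>J\<^sup>*\<^sup>* J\<^sup>*\<close> is a core for it; the form of the Friedrichs extension is represented
  by the closure of \<open>Q\<close>, which is contained in \<open>J\<^sup>*\<close>.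

  If \<open>H\<close> is extremal, energy limits of \<open>Q\<close> along \<open>S\<close> extend \<open>Q\<close> to a map on \<open>dom H\<close> that lies in \<open>J\<^sup>*\<close> and
  represents the form of \<open>H\<close>, so the inclusions of forms become inclusions of closed graphs. Conversely, if
  \<open>t_H\<close> is contained in the Krein form, then the energy of \<open>f\<close> in \<open>dom H\<close> equals \<open>\<parallel>g\<parallel>\<^sup>2\<close> for some \<open>(f, g)\<close> in \<open>J\<^sup>*\<close>
  with \<open>g\<close> in the closure of the range of \<open>Q\<close>, and \<open>h\<close> in \<open>dom S\<close> with \<open>Q h\<close> near \<open>g\<close> approximates \<open>f\<close> in energy.
\<close>

section \<open>Complex inner products and the Cauchy-Schwarz inequality\<close>

lemma scaleC_zero_right [simp]: "a *\<^sub>C (0::'a::complex_vector) = 0"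
  using scaleC_add_right[of a 0 0] by simp

lemma scaleC_minus_right: "a *\<^sub>C (- x) = - (a *\<^sub>C (x::'a::complex_vector))"
  using scaleC_add_right[of a x "-x"] by (simp add: add_eq_0_iff)

lemma scaleC_minus1: "(-1) *\<^sub>C x = - (x::'a::complex_vector)"
  using scaleR_scaleC[of "-1" x] by simp

lemma cinner_scaleR_left: "cinner (r *\<^sub>R x) y = of_real r * cinner x y"
  by (simp add: scaleR_scaleC cinner_scaleC_left)

lemma cinner_add_right: "cinner x (y + z) = cinner x y + cinner x z"
  by (subst (1 2 3) cinner_commute) (simp add: cinner_add_left)

lemma cinner_scaleC_right: "cinner x (a *\<^sub>C y) = cnj a * cinner x y"
  by (subst (1 2) cinner_commute) (simp add: cinner_scaleC_left)

lemma cinner_scaleR_right: "cinner x (r *\<^sub>R y) = of_real r * cinner x y"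
  by (simp add: scaleR_scaleC cinner_scaleC_right)

lemma norm_sq_cinner: "(norm x)\<^sup>2 = Re (cinner x x)"
  by (simp add: norm_eq_sqrt_cinner cinner_ge_zero)

lemma cinner_self: "cinner x x = of_real ((norm x)\<^sup>2)"
  by (simp add: norm_sq_cinner cinner_self_real of_real_Re)

definition csubspace :: "'a::complex_vector set \<Rightarrow> bool" where
  "csubspace M \<longleftrightarrow> 0 \<in> M \<and> (\<forall>x\<in>M. \<forall>y\<in>M. x + y \<in> M) \<and> (\<forall>a. \<forall>x\<in>M. a *\<^sub>C x \<in> M)"

lemma csubspaceD:
  assumes "csubspace M"
  shows "0 \<in> M"
    and "x \<in> M \<Longrightarrow> y \<in> M \<Longrightarrow> x + y \<in> M"
    and "x \<in> M \<Longrightarrow> a *\<^sub>C x \<in> M"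
    and "x \<in> M \<Longrightarrow> y \<in> M \<Longrightarrow> x - y \<in> M"
    and "x \<in> M \<Longrightarrow> r *\<^sub>R x \<in> M"
proof -
  show 1: "0 \<in> M" "x \<in> M \<Longrightarrow> y \<in> M \<Longrightarrow> x + y \<in> M" "x \<in> M \<Longrightarrow> a *\<^sub>C x \<in> M" for x y a
    using assms by (auto simp: csubspace_def)
  show "x \<in> M \<Longrightarrow> y \<in> M \<Longrightarrow> x - y \<in> M"
    using 1(2)[of x "- y"] 1(3)[of y "-1"] by (simp add: scaleC_minus1)
  show "x \<in> M \<Longrightarrow> r *\<^sub>R x \<in> M"
    using 1(3) by (simp add: scaleR_scaleC)
qed

text \<open>Stated for a form that may degenerate, on a subspace only, so that it covers both
  \<open>cinner\<close> and the energy of a relation.\<close>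

lemma semi_inner_cauchy_schwarz:
  fixes B :: "'v::complex_vector \<Rightarrow> 'v \<Rightarrow> complex"
  assumes M: "csubspace M" and x: "x \<in> M" and y: "y \<in> M"
    and add: "\<And>x y z. x \<in> M \<Longrightarrow> y \<in> M \<Longrightarrow> z \<in> M \<Longrightarrow> B (x + y) z = B x z + B y z"
    and scale: "\<And>a x z. x \<in> M \<Longrightarrow> z \<in> M \<Longrightarrow> B (a *\<^sub>C x) z = a * B x z"
    and herm: "\<And>x y. x \<in> M \<Longrightarrow> y \<in> M \<Longrightarrow> B x y = cnj (B y x)"
    and nonneg: "\<And>x. x \<in> M \<Longrightarrow> 0 \<le> Re (B x x)"
  shows "(cmod (B x y))\<^sup>2 \<le> Re (B x x) * Re (B y y)"
proof -
  define a where "a = B x y"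
  note M' = csubspaceD[OF M]
  \<comment> \<open>The value of \<open>B\<close> at \<open>x + b y\<close> with
    \<open>b = t a\<close>: the factor \<open>a\<close> makes both cross terms equal to the real
    number \<open>t * (cmod a)\<^sup>2\<close>.\<close>
  have pos: "0 \<le> Re (B x x) + 2 * t * (cmod a)\<^sup>2 + t\<^sup>2 * (cmod a)\<^sup>2 * Re (B y y)" for t :: real
  proof -
    define b where "b = of_real t * a"
    have by_: "b *\<^sub>C y \<in> M" using M' y by blast
    have r: "B z (b *\<^sub>C y) = cnj b * B z y" if "z \<in> M" for z
      using herm[OF that by_] scale[OF y that, of b] herm[OF that y] by simp
    have "B (x + b *\<^sub>C y) (x + b *\<^sub>C y) = B x (x + b *\<^sub>C y) + b * B y (x + b *\<^sub>C y)"
      using M' x y by_ by (simp add: add scale)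
    moreover have "B z (x + b *\<^sub>C y) = B z x + cnj b * B z y" if "z \<in> M" for z
    proof -
      have "B z (x + b *\<^sub>C y) = cnj (B x z + B (b *\<^sub>C y) z)"
        using herm[of z "x + b *\<^sub>C y"] add[OF x by_ that] that M' x by_ by simp
      also have "\<dots> = B z x + B z (b *\<^sub>C y)"
        using herm[OF that x] herm[OF that by_] by simp
      finally show ?thesis using r[OF that] by simp
    qed
    ultimately have *: "B (x + b *\<^sub>C y) (x + b *\<^sub>C y) = B x x + cnj b * a + b * (cnj a + cnj b * B y y)"
      using x y herm[OF y x] by (simp add: a_def algebra_simps)
    have 1: "Re (cnj b * a) = t * (cmod a)\<^sup>2" "Re (b * cnj a) = t * (cmod a)\<^sup>2"
      by (simp_all add: b_def cmod_power2 distrib_left) (simp_all add: power2_eq_square)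
    have "b * cnj b = of_real (t\<^sup>2 * (cmod a)\<^sup>2)"
      using complex_norm_square[of a] by (simp add: b_def power2_eq_square)
    hence 2: "Re (b * (cnj b * B y y)) = t\<^sup>2 * (cmod a)\<^sup>2 * Re (B y y)"
      by (simp only: mult.assoc[symmetric]) simp
    have "0 \<le> Re (B (x + b *\<^sub>C y) (x + b *\<^sub>C y))" using nonneg M' x by_ by blast
    thus ?thesis unfolding * using 1 2 by (simp add: distrib_left del: times_complex.sel)
  qed
  show ?thesis
  proof (cases "Re (B y y) = 0")
    case True
    have "cmod a = 0"
    proof (rule ccontr)
      assume "cmod a \<noteq> 0"
      hence p: "(cmod a)\<^sup>2 > 0" by simp
      \<comment> \<open>Here the polynomial is affine in \<open>t\<close>; unless
        \<open>a = 0\<close>, this \<open>t\<close> gives it the value -1.\<close>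
      have "0 \<le> Re (B x x) + 2 * (- (Re (B x x) + 1) / (2 * (cmod a)\<^sup>2)) * (cmod a)\<^sup>2"
        using pos[of "- (Re (B x x) + 1) / (2 * (cmod a)\<^sup>2)"] True by simp
      also have "\<dots> = -1" using p by (simp add: field_simps)
      finally show False by simp
    qed
    thus ?thesis using True by (simp add: a_def)
  next
    case False
    hence p: "Re (B y y) > 0" using nonneg[OF y] by simp
    \<comment> \<open>The minimizing \<open>t\<close> of the quadratic polynomial.\<close>
    have "0 \<le> Re (B x x) - (cmod a)\<^sup>2 / Re (B y y)"
      using pos[of "- 1 / Re (B y y)"] p by (simp add: field_simps power2_eq_square)
    thus ?thesis using p by (simp add: a_def field_simps)
  qed
qed

lemma cinner_cauchy_schwarz: "cmod (cinner x y) \<le> norm x * norm (y::'a::complex_inner)"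
proof -
  have "(cmod (cinner x y))\<^sup>2 \<le> Re (cinner x x) * Re (cinner y y)"
    by (rule semi_inner_cauchy_schwarz[where M = UNIV])
      (auto simp: csubspace_def cinner_add_left cinner_scaleC_left cinner_ge_zero intro: cinner_commute)
  also have "\<dots> = (norm x * norm y)\<^sup>2" by (simp add: norm_sq_cinner power_mult_distrib)
  finally show ?thesis by (rule power2_le_imp_le) simp
qed

lemma bounded_bilinear_cinner: "bounded_bilinear (cinner :: 'a::complex_inner \<Rightarrow> 'a \<Rightarrow> complex)"
  by standard
    (auto simp: cinner_add_left cinner_add_right cinner_scaleR_left cinner_scaleR_right scaleR_conv_of_real
      intro!: exI[of _ 1] cinner_cauchy_schwarz)

lemmas tendsto_cinner [tendsto_intros] = bounded_bilinear.tendsto[OF bounded_bilinear_cinner]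
lemmas continuous_on_cinner [continuous_intros] =
  bounded_bilinear.continuous_on[OF bounded_bilinear_cinner]
lemmas cinner_zero_left [simp] = bounded_bilinear.zero_left[OF bounded_bilinear_cinner]
lemmas cinner_zero_right [simp] = bounded_bilinear.zero_right[OF bounded_bilinear_cinner]
lemmas cinner_minus_left = bounded_bilinear.minus_left[OF bounded_bilinear_cinner]
lemmas cinner_minus_right = bounded_bilinear.minus_right[OF bounded_bilinear_cinner]
lemmas cinner_diff_left = bounded_bilinear.diff_left[OF bounded_bilinear_cinner]
lemmas cinner_diff_right = bounded_bilinear.diff_right[OF bounded_bilinear_cinner]
lemmas cinner_linear = cinner_add_left cinner_add_right cinner_diff_left cinner_diff_right
  cinner_minus_left cinner_minus_right cinner_scaleR_left cinner_scaleR_right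
  cinner_scaleC_left cinner_scaleC_right

lemma norm_scaleC: "norm (a *\<^sub>C z) = cmod a * norm (z::'a::complex_inner)"
proof -
  have "cinner (a *\<^sub>C z) (a *\<^sub>C z) = of_real ((cmod a)\<^sup>2 * (norm z)\<^sup>2)"
    unfolding cinner_scaleC_left cinner_scaleC_right cinner_self[of z] of_real_mult complex_norm_square
    by (simp add: mult_ac)
  hence "(norm (a *\<^sub>C z))\<^sup>2 = (cmod a * norm z)\<^sup>2"
    by (simp add: norm_sq_cinner[of "a *\<^sub>C z"] power_mult_distrib)
  thus ?thesis by simp
qed

lemma parallelogram:
  "(norm (x + y))\<^sup>2 + (norm (x - y))\<^sup>2 = 2 * (norm x)\<^sup>2 + 2 * (norm (y::'a::complex_inner))\<^sup>2"
  by (simp add: norm_sq_cinner cinner_linear)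

section \<open>The product Hilbert space, in which linear relations are subspaces\<close>

instantiation prod :: (complex_vector, complex_vector) complex_vector
begin
definition "a *\<^sub>C p = (a *\<^sub>C fst p, a *\<^sub>C snd p)"
instance
  by standard
    (auto simp: scaleC_prod_def scaleC_add_right scaleC_add_left scaleC_scaleC scaleC_one
      scaleR_scaleC prod_eq_iff)
end

lemma scaleC_Pair [simp]: "a *\<^sub>C (x, y) = (a *\<^sub>C x, a *\<^sub>C y)"
  by (simp add: scaleC_prod_def)

lemma fst_scaleC [simp]: "fst (a *\<^sub>C p) = a *\<^sub>C fst p"
  and snd_scaleC [simp]: "snd (a *\<^sub>C p) = a *\<^sub>C snd p"
  by (simp_all add: scaleC_prod_def)

instantiation prod :: (complex_inner, complex_inner) complex_inner
begin
definition "cinner p q = cinner (fst p) (fst q) + cinner (snd p) (snd q)"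
instance
proof
  fix p q r :: "'a \<times> 'b" and a :: complex
  show "cinner p q = cnj (cinner q p)"
    using cinner_commute[of "fst p" "fst q"] cinner_commute[of "snd p" "snd q"]
    by (simp add: cinner_prod_def)
  show "cinner (p + q) r = cinner p r + cinner q r"
    by (simp add: cinner_prod_def cinner_linear)
  show "cinner (a *\<^sub>C p) q = a * cinner p q"
    by (simp add: cinner_prod_def cinner_linear algebra_simps)
  show "cinner p p \<in> \<real>"
    by (simp add: cinner_prod_def cinner_self_real)
  show "0 \<le> Re (cinner p p)"
    by (simp add: cinner_prod_def cinner_ge_zero)
  show "cinner p p = 0 \<longleftrightarrow> p = 0"
    by (simp add: cinner_prod_def cinner_self prod_eq_iff sum_power2_eq_zero_iff
        flip: of_real_add of_real_power)
  show "norm p = sqrt (Re (cinner p p))"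
    by (simp add: cinner_prod_def norm_prod_def norm_sq_cinner)
qed
end

lemma cinner_Pair [simp]: "cinner (a, b) (c, d) = cinner a c + cinner b d"
  by (simp add: cinner_prod_def)

instance prod :: (chilbert_space, chilbert_space) chilbert_space ..

lemma lin_rel_iff_csubspace: "lin_rel T \<longleftrightarrow> csubspace T"
  unfolding lin_rel_def csubspace_def by (simp add: zero_prod_def split_paired_Ball_Sigma) fastforce

section \<open>Orthogonal projection onto closed subspaces\<close>

lemma csubspace_closure:
  fixes M :: "'a::complex_inner set"
  assumes "csubspace M" shows "csubspace (closure M)"
proof -
  note M = csubspaceD[OF assms]
  have "x + y \<in> closure M" if xy: "x \<in> closure M" "y \<in> closure M" for x y
  proof -
    obtain u v where "\<And>n. u n \<in> M" "u \<longlonglongrightarrow> x" "\<And>n. v n \<in> M" "v \<longlonglongrightarrow> y"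
      using xy unfolding closure_sequential by blast
    thus ?thesis unfolding closure_sequential
      by (intro exI[of _ "\<lambda>n. u n + v n"]) (auto intro: M(2) tendsto_intros)
  qed
  moreover have "a *\<^sub>C x \<in> closure M" if x: "x \<in> closure M" for a x
  proof -
    obtain u where u: "\<And>n. u n \<in> M" "u \<longlonglongrightarrow> x"
      using x by (auto simp: closure_sequential)
    have "norm (a *\<^sub>C u n - a *\<^sub>C x) = cmod a * norm (u n - x)" for n
    proof -
      have "a *\<^sub>C u n - a *\<^sub>C x = a *\<^sub>C (u n - x)"
        using scaleC_add_right[of a "u n" "- x"] by (simp add: scaleC_minus_right)
      thus ?thesis by (simp add: norm_scaleC)
    qed
    moreover have "(\<lambda>n. cmod a * norm (u n - x)) \<longlonglongrightarrow> 0"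
      using u(2) by (intro tendsto_mult_right_zero) (simp add: LIM_zero tendsto_norm_zero)
    ultimately have "(\<lambda>n. norm (a *\<^sub>C u n - a *\<^sub>C x)) \<longlonglongrightarrow> 0" by simp
    hence "(\<lambda>n. a *\<^sub>C u n - a *\<^sub>C x) \<longlonglongrightarrow> 0"
      by (rule tendsto_norm_zero_cancel)
    hence "(\<lambda>n. a *\<^sub>C u n) \<longlonglongrightarrow> a *\<^sub>C x" by (rule LIM_zero_cancel)
    thus ?thesis using u(1) unfolding closure_sequential
      by (intro exI[of _ "\<lambda>n. a *\<^sub>C u n"]) (simp add: M(3))
  qed
  moreover have "0 \<in> closure M" using M(1) closure_subset by blast
  ultimately show ?thesis by (simp add: csubspace_def)
qed

text \<open>A minimizing sequence for the distance to \<open>M\<close> is Cauchy by the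
  parallelogram law; moving its limit in the direction of \<open>y\<close> cannot decrease the
  distance, which forces orthogonality.\<close>

lemma projection_exists:
  fixes x :: "'a::chilbert_space"
  assumes M: "csubspace M" and cl: "closed M"
  obtains m where "m \<in> M" "\<And>y. y \<in> M \<Longrightarrow> cinner y (x - m) = 0"
proof -
  note M' = csubspaceD[OF M]
  define d where "d = infdist x M"
  have ne: "M \<noteq> {}" using M' by auto
  have d0: "d \<ge> 0" by (simp add: d_def infdist_nonneg)
  have dle: "d \<le> norm (x - y)" if "y \<in> M" for y
    using infdist_le[OF that, of x] by (simp add: d_def dist_norm)
  have "\<exists>y\<in>M. norm (x - y) < d + 1 / real (Suc n)" for n
  proof (rule ccontr)
    assume "\<not> ?thesis"
    hence "d + 1 / real (Suc n) \<le> dist x y" if "y \<in> M" for y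
      using that by (auto simp: dist_norm not_less)
    hence "d + 1 / real (Suc n) \<le> infdist x M"
      using ne by (simp add: infdist_def cINF_greatest)
    thus False by (simp add: d_def)
  qed
  then obtain u where u: "\<And>n. u n \<in> M" "\<And>n. norm (x - u n) < d + 1 / real (Suc n)"
    by metis
  \<comment> \<open>Bounds the excess of the squared distance of \<open>u n\<close> over the minimum
    \<open>d\<^sup>2\<close>.\<close>
  define w where "w n = (d + 1 / real (Suc n))\<^sup>2 - d\<^sup>2" for n
  have w0: "w \<longlonglongrightarrow> 0"
  proof -
    have "w \<longlonglongrightarrow> (d + 0)\<^sup>2 - d\<^sup>2" unfolding w_def
      by (intro tendsto_intros LIMSEQ_Suc[OF lim_1_over_n])
    thus ?thesis by simp
  qed
  have uw: "(norm (x - u n))\<^sup>2 \<le> d\<^sup>2 + w n" for n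
    using power_mono[OF less_imp_le[OF u(2)[of n]] norm_ge_zero, of 2] by (simp add: w_def)
  have diff: "(norm (u n - u m))\<^sup>2 \<le> 2 * w n + 2 * w m" for n m
  proof -
    have "(norm ((x - u n) + (x - u m)))\<^sup>2 + (norm ((x - u n) - (x - u m)))\<^sup>2
        = 2 * (norm (x - u n))\<^sup>2 + 2 * (norm (x - u m))\<^sup>2"
      by (rule parallelogram)
    moreover have "(norm ((x - u n) + (x - u m)))\<^sup>2 \<ge> 4 * d\<^sup>2"
    proof -
      \<comment> \<open>The midpoint of \<open>u n\<close> and \<open>u m\<close> lies in
        \<open>M\<close>, so its distance from \<open>x\<close> is at least
        \<open>d\<close>.\<close>
      have e: "(x - u n) + (x - u m) = 2 *\<^sub>R (x - (1/2) *\<^sub>R (u n + u m))"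
        by (simp add: scaleR_right_diff_distrib scaleR_2)
      have "d \<le> norm (x - (1/2) *\<^sub>R (u n + u m))"
        by (rule dle[OF M'(5)[OF M'(2)[OF u(1) u(1)]]])
      hence "d\<^sup>2 \<le> (norm (x - (1/2) *\<^sub>R (u n + u m)))\<^sup>2" using d0 by (rule power_mono)
      thus ?thesis unfolding e by (simp add: power_mult_distrib)
    qed
    moreover have "(x - u n) - (x - u m) = - (u n - u m)" by simp
    ultimately show ?thesis using uw[of n] uw[of m] by (simp only: norm_minus_cancel)
  qed
  have "Cauchy u"
  proof (rule CauchyI)
    fix e :: real assume e: "e > 0"
    hence "eventually (\<lambda>n. w n < e\<^sup>2 / 4) sequentially"
      using w0 by (intro order_tendstoD) auto
    then obtain N where N: "\<And>n. n \<ge> N \<Longrightarrow> w n < e\<^sup>2 / 4"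
      by (auto simp: eventually_sequentially)
    show "\<exists>N. \<forall>m\<ge>N. \<forall>n\<ge>N. norm (u m - u n) < e"
    proof (intro exI allI impI)
      fix m n assume "m \<ge> N" "n \<ge> N"
      hence "(norm (u m - u n))\<^sup>2 < e\<^sup>2" using N[of m] N[of n] diff[of m n] by linarith
      thus "norm (u m - u n) < e" using e by (simp add: power_less_imp_less_base)
    qed
  qed
  then obtain m where m: "u \<longlonglongrightarrow> m" using Cauchy_convergent convergent_def by blast
  have mM: "m \<in> M" using closed_sequentially[OF cl _ m] u by blast
  have "norm (x - m) \<le> d + 0"
  proof (rule LIMSEQ_le)
    show "(\<lambda>n. norm (x - u n)) \<longlonglongrightarrow> norm (x - m)" by (intro tendsto_intros m)
    show "(\<lambda>n. d + 1 / real (Suc n)) \<longlonglongrightarrow> d + 0"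
      by (intro tendsto_intros LIMSEQ_Suc[OF lim_1_over_n])
  qed (use u(2) in \<open>auto intro: less_imp_le\<close>)
  hence min: "(norm (x - m))\<^sup>2 \<le> (norm (x - y))\<^sup>2" if "y \<in> M" for y
    using dle[OF that] by (intro power_mono) auto
  have "cinner y (x - m) = 0" if y: "y \<in> M" for y
  proof -
    define a where "a = cinner (x - m) y"
    \<comment> \<open>The summand 1 keeps \<open>t\<close> defined at \<open>y = 0\<close> and gives
      \<open>t * (norm y)\<^sup>2 < 1\<close>, so the gain linear in \<open>t\<close> outweighs the
      quadratic term.\<close>
    define t where "t = 1 / ((norm y)\<^sup>2 + 1)"
    define z where "z = (of_real t * a) *\<^sub>C y"
    have n1: "(norm y)\<^sup>2 + 1 > 0" by (simp add: add_nonneg_pos)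
    hence t: "t > 0" "t * (norm y)\<^sup>2 < 1" by (auto simp: t_def)
    have az: "cinner (x - m) z = of_real (t * (cmod a)\<^sup>2)"
      using complex_norm_square[of a] by (simp add: z_def cinner_scaleC_right a_def mult_ac)
    have za: "cinner z (x - m) = of_real (t * (cmod a)\<^sup>2)"
      using cinner_commute[of z "x - m"] az by simp
    have zz: "cinner z z = of_real (t\<^sup>2 * (cmod a)\<^sup>2 * (norm y)\<^sup>2)"
      by (simp add: z_def cinner_self norm_scaleC norm_mult power_mult_distrib)
    have "m + z \<in> M" using M' mM y by (simp add: z_def)
    from min[OF this] have "(norm (x - m))\<^sup>2 \<le> (norm ((x - m) - z))\<^sup>2"
      by (simp add: diff_diff_eq)
    also have "\<dots> = (norm (x - m))\<^sup>2 - 2 * (t * (cmod a)\<^sup>2) + t\<^sup>2 * (cmod a)\<^sup>2 * (norm y)\<^sup>2"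
    proof -
      have "cinner ((x - m) - z) ((x - m) - z)
        = cinner (x - m) (x - m) - cinner (x - m) z - cinner z (x - m) + cinner z z"
        by (simp only: cinner_diff_left[of "x - m" z] cinner_diff_right[of _ "x - m" z]) simp
      thus ?thesis unfolding norm_sq_cinner[of "x - m - z"] norm_sq_cinner[of "x - m"] az za zz
        by simp
    qed
    finally have "(cmod a)\<^sup>2 * t * (2 - t * (norm y)\<^sup>2) \<le> 0"
      by (simp add: algebra_simps power2_eq_square)
    hence "(cmod a)\<^sup>2 \<le> 0" using t by (simp add: mult_le_0_iff)
    hence "a = 0" by simp
    thus ?thesis using cinner_commute[of y "x - m"] by (simp add: a_def)
  qed
  thus thesis using that mM by blast
qed

section \<open>Adjoints and closures of linear relations\<close>

lemma mem_closure_pair_iff: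
  "(x, y) \<in> closure R \<longleftrightarrow>
    (\<exists>u v. (\<forall>n. (u n, v n) \<in> R) \<and> u \<longlonglongrightarrow> x \<and> v \<longlonglongrightarrow> (y::'b::real_normed_vector))"
  for x :: "'a::real_normed_vector"
proof
  assume "(x, y) \<in> closure R"
  then obtain p where p: "\<And>n. p n \<in> R" "p \<longlonglongrightarrow> (x, y)"
    unfolding closure_sequential by blast
  show "\<exists>u v. (\<forall>n. (u n, v n) \<in> R) \<and> u \<longlonglongrightarrow> x \<and> v \<longlonglongrightarrow> y"
    using tendsto_fst[OF p(2)] tendsto_snd[OF p(2)] p(1)
    by (intro exI[of _ "\<lambda>n. fst (p n)"] exI[of _ "\<lambda>n. snd (p n)"]) simp
next
  assume "\<exists>u v. (\<forall>n. (u n, v n) \<in> R) \<and> u \<longlonglongrightarrow> x \<and> v \<longlonglongrightarrow> y"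
  then obtain u v where "\<forall>n. (u n, v n) \<in> R" "u \<longlonglongrightarrow> x" "v \<longlonglongrightarrow> y" by blast
  thus "(x, y) \<in> closure R"
    unfolding closure_sequential by (intro exI[of _ "\<lambda>n. (u n, v n)"]) (auto intro: tendsto_Pair)
qed

lemma csubspace_Domain:
  assumes "csubspace T" shows "csubspace (Domain T)"
  unfolding csubspace_def
proof (intro conjI ballI allI)
  show "0 \<in> Domain T" using csubspaceD(1)[OF assms] by (auto simp: zero_prod_def)
  show "x + y \<in> Domain T" if "x \<in> Domain T" "y \<in> Domain T" for x y
    using that csubspaceD(2)[OF assms] by (metis DomainE DomainI add_Pair)
  show "a *\<^sub>C x \<in> Domain T" if "x \<in> Domain T" for a x
    using that csubspaceD(3)[OF assms] by (metis DomainE DomainI scaleC_Pair)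
qed

lemma closed_adj:
  fixes T :: "('a::complex_inner \<times> 'b::complex_inner) set"
  shows "closed (adj T)"
proof -
  have "adj T = (\<Inter>(f, g)\<in>T. {p. cinner g (fst p) = cinner f (snd p)})"
    by (auto simp: adj_def)
  moreover have "closed {p :: 'b \<times> 'a. cinner g (fst p) = cinner f (snd p)}" for f :: 'a and g :: 'b
    by (intro closed_Collect_eq continuous_intros)
  ultimately show ?thesis by (auto simp: split_beta intro!: closed_INT)
qed

lemma csubspace_adj: "csubspace (adj T)"
  by (auto simp: csubspace_def adj_def zero_prod_def cinner_linear)

lemma adjD: "(h, k) \<in> adj T \<Longrightarrow> (f, g) \<in> T \<Longrightarrow> cinner g h = cinner f k"
  by (auto simp: adj_def)

lemma adjD': "(h, k) \<in> adj T \<Longrightarrow> (f, g) \<in> T \<Longrightarrow> cinner h g = cinner k f"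
  using adjD[of h k T f g] cinner_commute[of h g] cinner_commute[of k f] by simp

text \<open>The orthogonal complement of \<open>T\<close> is \<open>adj T\<close> with swapped entries and one sign changed.\<close>

lemma orthogonal_imp_adj:
  assumes "\<And>p. p \<in> T \<Longrightarrow> cinner p (a, b) = 0"
  shows "(b, - a) \<in> adj T"
proof -
  have "cinner g b = cinner f (- a)" if "(f, g) \<in> T" for f g
    using assms[OF that] by (simp add: cinner_minus_right add_eq_0_iff)
  thus ?thesis by (simp add: adj_def)
qed

lemma subset_adj_adj: "T \<subseteq> adj (adj T)"
  by (auto simp: adj_def) (metis cinner_commute)

text \<open>The residual \<open>(a, b)\<close> of the projection of \<open>p\<close> onto
  \<open>closure T\<close> lies in \<open>adj (adj T)\<close> and is orthogonal to \<open>T\<close>.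
  Orthogonality puts \<open>(b, - a)\<close> into \<open>adj T\<close>, and pairing the two gives
  zero for the sum of the squared norms of \<open>a\<close> and \<open>b\<close>.\<close>

lemma adj_adj:
  fixes T :: "('a::chilbert_space \<times> 'b::chilbert_space) set"
  assumes "csubspace T"
  shows "adj (adj T) = closure T"
proof
  show "closure T \<subseteq> adj (adj T)" by (intro closure_minimal closed_adj subset_adj_adj)
  show "adj (adj T) \<subseteq> closure T"
  proof
    fix p assume p: "p \<in> adj (adj T)"
    obtain m where m: "m \<in> closure T" "\<And>y. y \<in> closure T \<Longrightarrow> cinner y (p - m) = 0"
      using projection_exists[OF csubspace_closure[OF assms] closed_closure] by blast
    define a b where "a = fst (p - m)" and "b = snd (p - m)"
    have ab: "(a, b) = p - m" by (simp add: a_def b_def prod_eq_iff)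
    have "(b, - a) \<in> adj T"
      using m(2) closure_subset by (intro orthogonal_imp_adj) (auto simp: ab)
    moreover have "(a, b) \<in> adj (adj T)"
      unfolding ab using m(1) p \<open>closure T \<subseteq> adj (adj T)\<close> csubspaceD(4)[OF csubspace_adj] by blast
    ultimately have "cinner (- a) a = cinner b b" by (rule adjD[rotated])
    hence "cinner (a, b) (a, b) = 0" by (simp add: cinner_minus_left add_eq_0_iff)
    hence "p = m" unfolding ab cinner_eq_zero_iff by simp
    thus "p \<in> closure T" using m(1) by simp
  qed
qed

text \<open>A pair \<open>(0, k)\<close> in \<open>adj J\<close> has \<open>k\<close> orthogonal to
  \<open>Domain J\<close>. Hence restricting the second entries of \<open>adj J\<close> to the
  closure of \<open>Domain J\<close> leaves a single-valued relation.\<close>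

lemma mem_adj_closure_Domain_zero:
  assumes "(0, k) \<in> adj J" and "k \<in> closure (Domain J)"
  shows "k = 0"
proof -
  have "Domain J \<subseteq> {d. cinner d k = 0}"
    using adjD[OF assms(1)] by fastforce
  moreover have "closed {d. cinner d k = 0}" by (intro closed_Collect_eq continuous_intros)
  ultimately have "closure (Domain J) \<subseteq> {d. cinner d k = 0}" by (rule closure_minimal)
  thus ?thesis using assms(2) cinner_eq_zero_iff by blast
qed

text \<open>Von Neumann's theorem for linear relations: the domain of \<open>J\<^sup>*\<^sup>* J\<^sup>*\<close> is a core of the operator
  part of \<open>J\<^sup>*\<close>. Surjectivity of \<open>1 + J\<^sup>*\<^sup>* J\<^sup>*\<close> comes from decomposing \<open>(u, 0)\<close> along \<open>J\<^sup>*\<close>.\<close>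

lemma adj_core:
  fixes J :: "('b::chilbert_space \<times> 'a::chilbert_space) set"
  assumes J: "csubspace J"
  shows "closure {(f, g). (f, g) \<in> adj J \<and> g \<in> Domain (adj (adj J))}
    = {(f, g). (f, g) \<in> adj J \<and> g \<in> closure (Domain J)}" (is "closure ?R = ?L")
proof
  have R_def: "?R = {p. p \<in> adj J \<and> snd p \<in> Domain (closure J)}" by (auto simp: adj_adj[OF J])
  have L_def: "?L = {p. p \<in> adj J \<and> snd p \<in> closure (Domain J)}" by auto
  have sub: "Domain (closure J) \<subseteq> closure (Domain J)"
  proof
    fix d assume "d \<in> Domain (closure J)"
    then obtain e u v where "\<And>n. (u n, v n) \<in> J" "u \<longlonglongrightarrow> d" "v \<longlonglongrightarrow> e"
      unfolding Domain_iff mem_closure_pair_iff by blast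
    thus "d \<in> closure (Domain J)" unfolding closure_sequential by blast
  qed
  have clD: "csubspace (closure (Domain J))" and DcJ: "csubspace (Domain (closure J))"
    by (intro csubspace_closure csubspace_Domain J)+
  have L: "csubspace ?L" unfolding L_def
    using csubspaceD[OF clD] csubspaceD[OF csubspace_adj] by (auto simp: csubspace_def)
  have R: "csubspace ?R" unfolding R_def
    using csubspaceD[OF DcJ] csubspaceD[OF csubspace_adj] by (auto simp: csubspace_def)
  have "closed (adj J \<inter> snd -` closure (Domain J))"
    by (intro closed_Int closed_adj continuous_closed_vimage closed_closure) (auto intro: continuous_intros)
  moreover have "?L = adj J \<inter> snd -` closure (Domain J)" by auto
  ultimately have "closed ?L" by simp
  thus RL: "closure ?R \<subseteq> ?L" using sub by (intro closure_minimal) (auto simp: adj_adj[OF J])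
  show "?L \<subseteq> closure ?R"
  proof
    fix p assume p: "p \<in> ?L"
    obtain m where m: "m \<in> closure ?R" "\<And>y. y \<in> closure ?R \<Longrightarrow> cinner y (p - m) = 0"
      using projection_exists[OF csubspace_closure[OF R] closed_closure] by blast
    define u k where "u = fst (p - m)" and "k = snd (p - m)"
    have uk: "(u, k) = p - m" by (simp add: u_def k_def prod_eq_iff)
    have uL: "(u, k) \<in> ?L"
      unfolding uk by (rule csubspaceD(4)[OF L p subsetD[OF RL m(1)]])
    obtain q where q: "q \<in> adj J" "\<And>y. y \<in> adj J \<Longrightarrow> cinner y ((u, 0) - q) = 0"
      using projection_exists[OF csubspace_adj closed_adj] by blast
    define f g where "f = fst q" and "g = snd q"
    have fg: "q = (f, g)" by (simp add: f_def g_def)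
    \<comment> \<open>The remainder \<open>(u - f, - g)\<close> is orthogonal to
      \<open>adj J\<close>; up to sign and order of entries it lies in \<open>adj (adj J)\<close>,
      which puts \<open>g\<close> into the domain required by \<open>?R\<close>.\<close>
    have "(- g, - (u - f)) \<in> adj (adj J)"
      using q(2) by (intro orthogonal_imp_adj) (simp add: fg)
    hence gu: "(g, u - f) \<in> adj (adj J)"
      using csubspaceD(3)[OF csubspace_adj, of _ "adj J" "-1"] by (force simp: scaleC_minus1)
    hence fgR: "(f, g) \<in> ?R" using q(1) fg by auto
    have fgu: "cinner (f, g) (u, k) = 0"
      unfolding uk by (intro m(2) subsetD[OF closure_subset fgR])
    \<comment> \<open>Orthogonality of the residual to \<open>(f, g)\<close> reads
      \<open>cinner f u + cinner g k = 0\<close>; replacing the second term by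
      \<open>cinner (u - f) u\<close> leaves \<open>cinner u u = 0\<close>.\<close>
    have "cinner k g = cinner u (u - f)" using adjD[OF gu] uL by auto
    hence "cinner g k = cinner (u - f) u"
      using cinner_commute[of g k] cinner_commute[of "u - f" u] by simp
    hence "cinner u u = 0" using fgu by (simp add: cinner_diff_left)
    hence u0: "u = 0" by (simp add: cinner_eq_zero_iff)
    hence "k = 0" using uL mem_adj_closure_Domain_zero by blast
    hence "p = m" using uk u0 by (simp add: zero_prod_def[symmetric])
    thus "p \<in> closure ?R" using m(1) by simp
  qed
qed

section \<open>Closed forms and the relations that represent them\<close>

text \<open>\<open>R\<close> need not be an operator or closed here: it is automatically closable, as \<open>form_rep_closable\<close> shows.\<close>

definition form_rep :: "('a::complex_inner \<times> 'a) set \<Rightarrow> real \<Rightarrow> ('a \<times> 'b::complex_inner) set \<Rightarrow> bool" where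
  "form_rep T c R \<longleftrightarrow> csubspace R \<and> Domain R = Domain T \<and>
    (\<forall>f f' g e k. (f, f') \<in> T \<longrightarrow> (f, g) \<in> R \<longrightarrow> (e, k) \<in> R \<longrightarrow>
       cinner f' e = of_real c * cinner f e + cinner g k)"

lemma fst_form_of: "fst (form_of T) = Domain T"
  by (simp add: form_of_def)

text \<open>The identity in \<open>form_rep\<close> holds for every image of \<open>f\<close>, so
  the one picked by \<open>SOME\<close> does not matter.\<close>

lemma form_of_rep:
  assumes "form_rep T c R" and "(f, g) \<in> R" and "(e, k) \<in> R"
  shows "snd (form_of T) f e = of_real c * cinner f e + cinner g k"
proof -
  have "\<exists>f'. (f, f') \<in> T" using assms by (auto simp: form_rep_def)
  hence "(f, SOME f'. (f, f') \<in> T) \<in> T" by (rule someI_ex)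
  thus ?thesis using assms unfolding form_rep_def form_of_def snd_conv by blast
qed

text \<open>For a fixed \<open>(e, l)\<close> in \<open>R\<close>, the form identity writes
  \<open>cinner l (g n)\<close> through \<open>x n\<close>, which tends to 0. So \<open>k\<close> is
  orthogonal to the range of \<open>R\<close>, hence to each \<open>g n\<close> and to their limit
  \<open>k\<close>.\<close>

lemma form_rep_closable:
  fixes R :: "('a::complex_inner \<times> 'b::complex_inner) set"
  assumes rep: "form_rep T c R" and k: "(0, k) \<in> closure R"
  shows "k = 0"
proof -
  obtain x g where xg: "\<And>n. (x n, g n) \<in> R" "x \<longlonglongrightarrow> 0" "g \<longlonglongrightarrow> k"
    using k unfolding mem_closure_pair_iff by blast
  have "cinner l k = 0" if l: "(e, l) \<in> R" for e l
  proof -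
    obtain e' where e': "(e, e') \<in> T" using l rep unfolding form_rep_def by blast
    have "cinner l (g n) = cinner e' (x n) - of_real c * cinner e (x n)" for n
      using rep e' l xg(1) unfolding form_rep_def by (metis add_diff_cancel_left')
    moreover have "(\<lambda>n. cinner e' (x n) - of_real c * cinner e (x n)) \<longlonglongrightarrow> cinner e' 0 - of_real c * cinner e 0"
      by (intro tendsto_intros xg)
    moreover have "(\<lambda>n. cinner l (g n)) \<longlonglongrightarrow> cinner l k" by (intro tendsto_intros xg)
    ultimately show ?thesis by (simp add: LIMSEQ_unique)
  qed
  hence "cinner (g n) k = 0" for n using xg(1) by blast
  moreover have "(\<lambda>n. cinner (g n) k) \<longlonglongrightarrow> cinner k k" by (intro tendsto_intros xg)
  ultimately have "cinner k k = 0" by (simp add: LIMSEQ_const_iff)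
  thus ?thesis by (simp add: cinner_eq_zero_iff)
qed

text \<open>On differences the form equals \<open>c\<close> times the squared norm of the arguments
  plus that of their images. The first part vanishes along a convergent sequence whatever the sign
  of \<open>c\<close>, so being Cauchy in the form makes the images Cauchy.\<close>

lemma form_conv_imp_rep:
  fixes R :: "('a::complex_inner \<times> 'b::chilbert_space) set"
  assumes rep: "form_rep T c R" and x: "form_conv (form_of T) x \<phi>"
  obtains g k where "\<And>n. (x n, g n) \<in> R" "g \<longlonglongrightarrow> k" "(\<phi>, k) \<in> closure R"
proof -
  have sub: "csubspace R" using rep by (simp add: form_rep_def)
  have "x n \<in> Domain R" for n using x rep by (simp add: form_conv_def form_of_def form_rep_def)
  then obtain g where g: "\<And>n. (x n, g n) \<in> R" unfolding Domain_iff by metis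
  have x\<phi>: "x \<longlonglongrightarrow> \<phi>" using x by (simp add: form_conv_def)
  have t: "snd (form_of T) (x n - x m) (x n - x m)
      = of_real (c * (norm (x n - x m))\<^sup>2 + (norm (g n - g m))\<^sup>2)" for n m
  proof -
    have "(x n - x m, g n - g m) \<in> R" using csubspaceD(4)[OF sub g g] by simp
    from form_of_rep[OF rep this this] show ?thesis by (simp add: cinner_self)
  qed
  have "Cauchy g"
  proof (rule CauchyI)
    fix e :: real assume e: "e > 0"
    \<comment> \<open>Chosen so that \<open>(\<bar>c\<bar> + 1) * d\<^sup>2\<close> is half of
      \<open>e\<^sup>2\<close>.\<close>
    define d where "d = e / sqrt (2 * (\<bar>c\<bar> + 1))"
    have d: "d > 0" "d\<^sup>2 = e\<^sup>2 / (2 * (\<bar>c\<bar> + 1))"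
      using e by (simp_all add: d_def power_divide)
    obtain N1 where N1: "\<And>n m. n \<ge> N1 \<Longrightarrow> m \<ge> N1 \<Longrightarrow> cmod (snd (form_of T) (x n - x m) (x n - x m)) < e\<^sup>2 / 2"
      using x e unfolding form_conv_def by (meson half_gt_zero zero_less_power)
    obtain N2 where N2: "\<And>n m. n \<ge> N2 \<Longrightarrow> m \<ge> N2 \<Longrightarrow> norm (x n - x m) < d"
      using CauchyD[OF LIMSEQ_imp_Cauchy[OF x\<phi>] d(1)] by blast
    show "\<exists>N. \<forall>m\<ge>N. \<forall>n\<ge>N. norm (g m - g n) < e"
    proof (intro exI allI impI)
      fix m n assume mn: "m \<ge> max N1 N2" "n \<ge> max N1 N2"
      have 1: "\<bar>c * (norm (x m - x n))\<^sup>2 + (norm (g m - g n))\<^sup>2\<bar> < e\<^sup>2 / 2"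
        using N1[of m n] mn unfolding t norm_of_real by simp
      have "(norm (x m - x n))\<^sup>2 \<le> d\<^sup>2" using N2[of m n] mn by (intro power_mono) auto
      hence "\<bar>c\<bar> * (norm (x m - x n))\<^sup>2 \<le> (\<bar>c\<bar> + 1) * d\<^sup>2" by (intro mult_mono) auto
      also have "\<dots> = e\<^sup>2 / 2" by (simp add: d(2) field_simps)
      finally have "\<bar>c * (norm (x m - x n))\<^sup>2\<bar> \<le> e\<^sup>2 / 2" by (simp add: abs_mult)
      hence "(norm (g m - g n))\<^sup>2 < e\<^sup>2" using 1 by linarith
      thus "norm (g m - g n) < e" using e by (simp add: power_less_imp_less_base)
    qed
  qed
  then obtain k where k: "g \<longlonglongrightarrow> k" using Cauchy_convergent convergent_def by blast
  hence "(\<phi>, k) \<in> closure R" using g x\<phi> unfolding mem_closure_pair_iff by blast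
  thus thesis using that g k by blast
qed

lemma rep_imp_form_conv:
  assumes rep: "form_rep T c R" and k: "(\<phi>, k) \<in> closure R"
  obtains x where "form_conv (form_of T) x \<phi>"
proof -
  have sub: "csubspace R" using rep by (simp add: form_rep_def)
  obtain x g where xg: "\<And>n. (x n, g n) \<in> R" "x \<longlonglongrightarrow> \<phi>" "g \<longlonglongrightarrow> k"
    using k unfolding mem_closure_pair_iff by blast
  have t: "snd (form_of T) (x n - x m) (x n - x m)
      = of_real (c * (norm (x n - x m))\<^sup>2 + (norm (g n - g m))\<^sup>2)" for n m
  proof -
    have "(x n - x m, g n - g m) \<in> R" using csubspaceD(4)[OF sub xg(1) xg(1)] by simp
    from form_of_rep[OF rep this this] show ?thesis by (simp add: cinner_self)
  qed
  have "\<exists>N. \<forall>n\<ge>N. \<forall>m\<ge>N. cmod (snd (form_of T) (x n - x m) (x n - x m)) < e" if e: "e > 0" for e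
  proof -
    \<comment> \<open>The two parts sum to at most \<open>(\<bar>c\<bar> + 1) * d\<^sup>2\<close>;
      the constant 2 makes the bound by \<open>e\<close> strict.\<close>
    define d where "d = sqrt (e / (\<bar>c\<bar> + 2))"
    have d: "d > 0" "d\<^sup>2 = e / (\<bar>c\<bar> + 2)" using e by (auto simp: d_def)
    obtain N1 where N1: "\<And>n m. n \<ge> N1 \<Longrightarrow> m \<ge> N1 \<Longrightarrow> norm (x n - x m) < d"
      using CauchyD[OF LIMSEQ_imp_Cauchy[OF xg(2)] d(1)] by blast
    obtain N2 where N2: "\<And>n m. n \<ge> N2 \<Longrightarrow> m \<ge> N2 \<Longrightarrow> norm (g n - g m) < d"
      using CauchyD[OF LIMSEQ_imp_Cauchy[OF xg(3)] d(1)] by blast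
    show ?thesis
    proof (intro exI allI impI)
      fix n m assume mn: "n \<ge> max N1 N2" "m \<ge> max N1 N2"
      have x: "(norm (x n - x m))\<^sup>2 \<le> d\<^sup>2" using N1[of n m] mn by (intro power_mono) auto
      have g: "(norm (g n - g m))\<^sup>2 \<le> d\<^sup>2" using N2[of n m] mn by (intro power_mono) auto
      have "\<bar>c * (norm (x n - x m))\<^sup>2 + (norm (g n - g m))\<^sup>2\<bar> \<le> \<bar>c\<bar> * (norm (x n - x m))\<^sup>2 + (norm (g n - g m))\<^sup>2"
        by (rule order_trans[OF abs_triangle_ineq]) (simp add: abs_mult)
      also have "\<dots> \<le> \<bar>c\<bar> * d\<^sup>2 + d\<^sup>2" using x g by (intro add_mono mult_left_mono) auto
      also have "\<dots> < (\<bar>c\<bar> + 2) * d\<^sup>2" using d(1) by (simp add: distrib_right)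
      also have "\<dots> = e" by (simp add: d(2) add_nonneg_eq_0_iff)
      finally show "cmod (snd (form_of T) (x n - x m) (x n - x m)) < e" unfolding t norm_of_real .
    qed
  qed
  moreover have "x n \<in> Domain T" for n using xg(1) rep unfolding form_rep_def by blast
  ultimately have "form_conv (form_of T) x \<phi>"
    using xg(2) by (simp add: form_conv_def fst_form_of)
  thus thesis by (rule that)
qed

lemma fst_closed_form_rep:
  fixes R :: "('a::complex_inner \<times> 'b::chilbert_space) set"
  assumes rep: "form_rep T c R"
  shows "fst (closed_form T) = Domain (closure R)"
proof -
  have "(\<exists>x. form_conv (form_of T) x \<phi>) \<longleftrightarrow> (\<exists>k. (\<phi>, k) \<in> closure R)" for \<phi>
    using form_conv_imp_rep[OF rep] rep_imp_form_conv[OF rep] by metis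
  thus ?thesis by (auto simp: closed_form_def form_closure_def)
qed

text \<open>By closability the images along any approximating sequences converge to the same
  \<open>k\<close> and \<open>l\<close>, so all limits agree and \<open>THE\<close> is well
  defined.\<close>

lemma snd_closed_form_rep:
  fixes R :: "('a::complex_inner \<times> 'b::chilbert_space) set"
  assumes rep: "form_rep T c R" and k: "(\<phi>, k) \<in> closure R" and l: "(\<psi>, l) \<in> closure R"
  shows "snd (closed_form T) \<phi> \<psi> = of_real c * cinner \<phi> \<psi> + cinner k l"
proof -
  have sub: "csubspace (closure R)" using rep by (simp add: form_rep_def csubspace_closure)
  have uniq: "k' = k''" if "(\<theta>, k') \<in> closure R" "(\<theta>, k'') \<in> closure R" for \<theta> k' k''
    using form_rep_closable[OF rep, of "k' - k''"] csubspaceD(4)[OF sub that] by simp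
  have lim: "(\<lambda>n. snd (form_of T) (x n) (y n)) \<longlonglongrightarrow> of_real c * cinner \<phi> \<psi> + cinner k l"
    if x: "form_conv (form_of T) x \<phi>" and y: "form_conv (form_of T) y \<psi>" for x y
  proof -
    obtain g where g: "\<And>n. (x n, g n) \<in> R" "g \<longlonglongrightarrow> k"
      using form_conv_imp_rep[OF rep x] uniq[OF k] by metis
    obtain h where h: "\<And>n. (y n, h n) \<in> R" "h \<longlonglongrightarrow> l"
      using form_conv_imp_rep[OF rep y] uniq[OF l] by metis
    have "x \<longlonglongrightarrow> \<phi>" "y \<longlonglongrightarrow> \<psi>" using x y by (auto simp: form_conv_def)
    thus ?thesis unfolding form_of_rep[OF rep g(1) h(1)] by (intro tendsto_intros g h)
  qed
  obtain x y where xy: "form_conv (form_of T) x \<phi>" "form_conv (form_of T) y \<psi>"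
    using rep_imp_form_conv[OF rep k] rep_imp_form_conv[OF rep l] by metis
  show ?thesis unfolding closed_form_def form_closure_def snd_conv
    by (rule the_equality) (use lim xy LIMSEQ_unique in blast)+
qed

lemma form_ext_rep:
  fixes R1 R2 :: "('a::complex_inner \<times> 'b::chilbert_space) set"
  assumes rep: "form_rep T1 c R1" "form_rep T2 c R2" and sub: "closure R1 \<subseteq> closure R2"
  shows "form_ext (closed_form T1) (closed_form T2)"
  unfolding form_ext_def fst_closed_form_rep[OF rep(1)] fst_closed_form_rep[OF rep(2)]
proof (intro conjI ballI)
  show "Domain (closure R1) \<subseteq> Domain (closure R2)" using sub by blast
  fix x y assume "x \<in> Domain (closure R1)" "y \<in> Domain (closure R1)"
  then obtain k l where "(x, k) \<in> closure R1" "(y, l) \<in> closure R1" by blast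
  thus "snd (closed_form T1) x y = snd (closed_form T2) x y"
    using sub snd_closed_form_rep[OF rep(1)] snd_closed_form_rep[OF rep(2)] by (metis subsetD)
qed

section \<open>Forms of relations given by a factorization\<close>

text \<open>\<open>A\<close> may be multivalued, so the intermediate element \<open>g0\<close>
  behind \<open>f'\<close> can differ from the given \<open>g\<close>. Pairing with an image
  \<open>e''\<close> of \<open>k\<close> under \<open>B\<close> shows that both have the same inner
  product with \<open>k\<close>. The Friedrichs and the Krein factorizations are both
  instances.\<close>

lemma form_rep_shift_relprod:
  assumes A: "csubspace A" and B: "csubspace B" and AB: "A \<subseteq> adj B"
  shows "form_rep (shift c (relprod B A)) c {(f, g). (f, g) \<in> A \<and> g \<in> Domain B}"
  unfolding form_rep_def
proof (intro conjI allI impI)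
  have "csubspace (Domain B)" by (rule csubspace_Domain[OF B])
  moreover have "{(f, g). (f, g) \<in> A \<and> g \<in> Domain B} = {p. p \<in> A \<and> snd p \<in> Domain B}" by auto
  ultimately show "csubspace {(f, g). (f, g) \<in> A \<and> g \<in> Domain B}"
    using A by (auto simp: csubspace_def)
  show "Domain {(f, g). (f, g) \<in> A \<and> g \<in> Domain B} = Domain (shift c (relprod B A))"
    by (auto simp: shift_def relprod_def Domain_iff)
next
  fix f f' g e k
  assume f': "(f, f') \<in> shift c (relprod B A)" and g: "(f, g) \<in> {(f, g). (f, g) \<in> A \<and> g \<in> Domain B}"
    and k: "(e, k) \<in> {(f, g). (f, g) \<in> A \<and> g \<in> Domain B}"
  obtain g0 f'' where f'': "f' = f'' + c *\<^sub>R f" "(f, g0) \<in> A" "(g0, f'') \<in> B"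
    using f' by (auto simp: shift_def relprod_def)
  obtain e'' where e'': "(k, e'') \<in> B" using k by auto
  have "cinner f'' e = cinner g0 k" using adjD[of e k B g0 f''] k AB f''(3) by auto
  also have "\<dots> = cinner f e''" using adjD'[of f g0 B k e''] AB f''(2) e'' by (auto)
  also have "\<dots> = cinner g k" using adjD'[of f g B k e''] AB g e'' by (auto)
  finally show "cinner f' e = of_real c * cinner f e + cinner g k"
    by (simp add: f''(1) cinner_linear)
qed

section \<open>The energy semi-inner product\<close>

text \<open>Defined on pairs, so that it is linear in the first argument without choosing images in
  a multivalued relation.\<close>

definition energy :: "real \<Rightarrow> 'a::complex_inner \<times> 'a \<Rightarrow> 'a \<times> 'a \<Rightarrow> complex" where
  "energy c p q = cinner (snd p - c *\<^sub>R fst p) (fst q)"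

lemma energy_add_left: "energy c (p + q) r = energy c p r + energy c q r"
  and energy_diff_left: "energy c (p - q) r = energy c p r - energy c q r"
  and energy_add_right: "energy c r (p + q) = energy c r p + energy c r q"
  and energy_diff_right: "energy c r (p - q) = energy c r p - energy c r q"
  by (simp_all add: energy_def cinner_linear algebra_simps)

lemmas energy_linear = energy_add_left energy_diff_left energy_add_right energy_diff_right

lemma energy_scaleC_left: "energy c (a *\<^sub>C p) q = a * energy c p q"
  by (simp add: energy_def cinner_linear algebra_simps)

lemma energy_commute:
  assumes "T \<subseteq> adj T" and "p \<in> T" and "q \<in> T"
  shows "energy c p q = cnj (energy c q p)"
proof -
  have "cinner (snd p) (fst q) = cinner (fst p) (snd q)"
    using adjD[of "fst q" "snd q" T "fst p" "snd p"] assms by auto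
  thus ?thesis
    using cinner_commute[of "fst p" "snd q"] cinner_commute[of "fst p" "fst q"]
    by (simp add: energy_def cinner_linear)
qed

lemma energy_nonneg:
  assumes "bounded_below_by T c" and "p \<in> T"
  shows "0 \<le> Re (energy c p p)"
proof -
  have "c * (norm (fst p))\<^sup>2 \<le> Re (cinner (snd p) (fst p))"
    using assms unfolding bounded_below_by_def by (metis prod.collapse)
  thus ?thesis by (simp add: energy_def cinner_linear cinner_self)
qed

lemma energy_cauchy_schwarz:
  assumes T: "csubspace T" "T \<subseteq> adj T" "bounded_below_by T c" and pq: "p \<in> T" "q \<in> T"
  shows "cmod (energy c p q) \<le> sqrt (Re (energy c p p)) * sqrt (Re (energy c q q))"
proof -
  have "(cmod (energy c p q))\<^sup>2 \<le> Re (energy c p p) * Re (energy c q q)"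
    by (rule semi_inner_cauchy_schwarz[OF T(1) pq energy_add_left energy_scaleC_left
        energy_commute[OF T(2)] energy_nonneg[OF T(3)]])
  hence "cmod (energy c p q) \<le> sqrt (Re (energy c p p) * Re (energy c q q))"
    by (rule real_le_rsqrt)
  thus ?thesis by (simp add: real_sqrt_mult)
qed

text \<open>Joint continuity in the energy seminorm, as for any semi-inner product by
  Cauchy-Schwarz.\<close>

lemma tendsto_energy:
  assumes T: "csubspace T" "T \<subseteq> adj T" "bounded_below_by T c"
    and X: "\<And>n. X n \<in> T" and Y: "\<And>n. Y n \<in> T" and pq: "p \<in> T" "q \<in> T"
    and Xp: "(\<lambda>n. Re (energy c (X n - p) (X n - p))) \<longlonglongrightarrow> 0"
    and Yq: "(\<lambda>n. Re (energy c (Y n - q) (Y n - q))) \<longlonglongrightarrow> 0"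
  shows "(\<lambda>n. energy c (X n) (Y n)) \<longlonglongrightarrow> energy c p q"
proof -
  define a where "a n = sqrt (Re (energy c (X n - p) (X n - p)))" for n
  define b where "b n = sqrt (Re (energy c (Y n - q) (Y n - q)))" for n
  have ab: "a \<longlonglongrightarrow> 0" "b \<longlonglongrightarrow> 0"
    unfolding a_def b_def using tendsto_real_sqrt[OF Xp] tendsto_real_sqrt[OF Yq] by simp_all
  note cs = energy_cauchy_schwarz[OF T]
  have d: "X n - p \<in> T" "Y n - q \<in> T" for n
    by (rule csubspaceD(4)[OF T(1) X pq(1)], rule csubspaceD(4)[OF T(1) Y pq(2)])
  \<comment> \<open>One bound for each term of the expansion around \<open>p\<close> and
    \<open>q\<close>: both increments, then one increment at a time.\<close>
  define r where "r n = a n * b n + (a n * sqrt (Re (energy c q q)) + sqrt (Re (energy c p p)) * b n)" for n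
  have "cmod (energy c (X n) (Y n) - energy c p q) \<le> r n" for n
  proof -
    have "energy c (X n) (Y n) - energy c p q
        = energy c (X n - p) (Y n - q) + (energy c (X n - p) q + energy c p (Y n - q))"
      by (simp add: energy_linear)
    also have "cmod \<dots> \<le> r n"
      unfolding r_def a_def b_def
      by (intro norm_triangle_le add_mono cs d pq)
    finally show ?thesis .
  qed
  moreover have "r \<longlonglongrightarrow> 0 * 0 + (0 * sqrt (Re (energy c q q)) + sqrt (Re (energy c p p)) * 0)"
    unfolding r_def by (intro tendsto_intros ab)
  hence "r \<longlonglongrightarrow> 0" by simp
  ultimately have "(\<lambda>n. energy c (X n) (Y n) - energy c p q) \<longlonglongrightarrow> 0"
    by (rule Lim_null_comparison[OF always_eventually[OF allI]])
  thus ?thesis by (rule LIM_zero_cancel)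
qed

section \<open>The closed form of a symmetric relation bounded below, on its domain\<close>

text \<open>Symmetry moves the image chosen by \<open>SOME\<close> to the other argument and back,
  so any image gives the same value.\<close>

lemma form_of_symmetric:
  assumes "T \<subseteq> adj T" and "p \<in> T" and "q \<in> T"
  shows "snd (form_of T) (fst p) (fst q) = cinner (snd p) (fst q)"
proof -
  have "(fst p, SOME f'. (fst p, f') \<in> T) \<in> T"
    using assms(2) by (intro someI_ex[of "\<lambda>f'. (fst p, f') \<in> T"]) (metis prod.collapse)
  hence "snd (form_of T) (fst p) (fst q) = cinner (fst p) (snd q)"
    using adjD[of "fst q" "snd q" T "fst p"] assms by (auto simp: form_of_def)
  also have "\<dots> = cinner (snd p) (fst q)"
    using adjD[of "fst q" "snd q" T "fst p" "snd p"] assms by auto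
  finally show ?thesis .
qed

text \<open>Closability of the form of \<open>T\<close>: with \<open>z n = X n - p\<close>, the mixed terms \<open>energy c (z n) (z m)\<close>
  vanish as \<open>m\<close> grows because \<open>fst (z m)\<close> tends to \<open>0\<close>.\<close>

lemma form_conv_energy:
  assumes T: "csubspace T" "T \<subseteq> adj T" "bounded_below_by T c"
    and X: "\<And>n. X n \<in> T" and p: "p \<in> T"
    and conv: "form_conv (form_of T) (\<lambda>n. fst (X n)) (fst p)"
  shows "(\<lambda>n. Re (energy c (X n - p) (X n - p))) \<longlonglongrightarrow> 0"
proof (rule LIMSEQ_I)
  fix e :: real assume e: "e > 0"
  define z where "z n = X n - p" for n
  have z: "z n \<in> T" "z n - z m \<in> T" for n m
    using csubspaceD(4)[OF T(1)] X p by (auto simp: z_def)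
  have X0: "(\<lambda>n. fst (X n)) \<longlonglongrightarrow> fst p" using conv by (simp add: form_conv_def)
  hence "(\<lambda>n. fst (z n)) \<longlonglongrightarrow> 0" by (simp add: z_def LIM_zero)
  hence mixed: "(\<lambda>m. Re (energy c (z n) (z m))) \<longlonglongrightarrow> 0" for n
    unfolding energy_def using tendsto_Re[OF tendsto_cinner[OF tendsto_const]] by force
  define d where "d = e / (4 * (\<bar>c\<bar> + 1))"
  have d: "d > 0" "\<bar>c\<bar> * d \<le> e / 4" using e by (auto simp: d_def field_simps)
  obtain N1 where N1: "\<And>n m. n \<ge> N1 \<Longrightarrow> m \<ge> N1 \<Longrightarrow>
      cmod (snd (form_of T) (fst (X n) - fst (X m)) (fst (X n) - fst (X m))) < e / 4"
    using conv e unfolding form_conv_def by (meson divide_pos_pos zero_less_numeral)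
  obtain N2 where N2: "\<And>n m. n \<ge> N2 \<Longrightarrow> m \<ge> N2 \<Longrightarrow> norm (fst (X n) - fst (X m)) < sqrt d"
    using CauchyD[OF LIMSEQ_imp_Cauchy[OF X0], of "sqrt d"] d(1) by auto
  have small: "Re (energy c (z n - z m) (z n - z m)) \<le> e / 2" if "n \<ge> max N1 N2" "m \<ge> max N1 N2" for n m
  proof -
    have zz: "z n - z m = X n - X m" by (simp add: z_def)
    have "cinner (snd (z n - z m)) (fst (z n - z m))
        = snd (form_of T) (fst (X n) - fst (X m)) (fst (X n) - fst (X m))"
      using form_of_symmetric[OF T(2) z(2) z(2), of n m n m] by (simp add: zz)
    hence "Re (cinner (snd (z n - z m)) (fst (z n - z m))) \<le> e / 4"
      using N1[of n m] that complex_Re_le_cmod by (metis less_imp_le max.bounded_iff order_trans)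
    moreover have "\<bar>c * (norm (fst (z n - z m)))\<^sup>2\<bar> \<le> e / 4"
    proof -
      have "(norm (fst (X n) - fst (X m)))\<^sup>2 \<le> (sqrt d)\<^sup>2"
        using N2[of n m] that by (intro power_mono) auto
      hence "\<bar>c\<bar> * (norm (fst (X n) - fst (X m)))\<^sup>2 \<le> \<bar>c\<bar> * d"
        using d(1) by (intro mult_left_mono) auto
      thus ?thesis using d(2) by (simp add: zz abs_mult)
    qed
    moreover have "Re (energy c (z n - z m) (z n - z m))
        = Re (cinner (snd (z n - z m)) (fst (z n - z m))) - c * (norm (fst (z n - z m)))\<^sup>2"
      unfolding energy_def cinner_diff_left[of "snd (z n - z m)"] cinner_scaleR_left cinner_self[of "fst (z n - z m)"]
      by simp
    ultimately show ?thesis by linarith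
  qed
  have "\<bar>Re (energy c (z n) (z n))\<bar> \<le> e / 2" if n: "n \<ge> max N1 N2" for n
  proof -
    \<comment> \<open>Expand the energy of \<open>z n - z m\<close> and drop the nonnegative energy
      of \<open>z m\<close>; then let \<open>m\<close> tend to infinity.\<close>
    have "Re (energy c (z n) (z n)) \<le> e / 2 + 2 * Re (energy c (z n) (z m))" if m: "m \<ge> max N1 N2" for m
      using small[OF n m] energy_nonneg[OF T(3) z(1)[of m]] energy_commute[OF T(2) z(1)[of n] z(1)[of m], of c]
      by (simp add: energy_linear)
    moreover have "(\<lambda>m. e / 2 + 2 * Re (energy c (z n) (z m))) \<longlonglongrightarrow> e / 2 + 2 * 0"
      by (intro tendsto_intros mixed)
    ultimately have "Re (energy c (z n) (z n)) \<le> e / 2 + 2 * 0"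
      by (intro LIMSEQ_le_const) blast+
    thus ?thesis using energy_nonneg[OF T(3) z(1)[of n]] by simp
  qed
  thus "\<exists>N. \<forall>n\<ge>N. norm (Re (energy c (X n - p) (X n - p)) - 0) < e"
    using e unfolding z_def by (intro exI[of _ "max N1 N2"]) (force)
qed

text \<open>Serves for a relation with no representing map at hand. All sequences converging to
  \<open>fst p\<close> in the form converge to \<open>p\<close> in energy, so their form values have
  one common limit.\<close>

lemma closed_form_on_domain:
  assumes T: "csubspace T" "T \<subseteq> adj T" "bounded_below_by T c" and p: "p \<in> T"
  shows "fst p \<in> fst (closed_form T)" (is ?A)
    and "snd (closed_form T) (fst p) (fst p) = cinner (snd p) (fst p)" (is ?B)
proof -
  have "(0, 0) \<in> T" using csubspaceD(1)[OF T(1)] by (simp add: zero_prod_def)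
  from form_of_symmetric[OF T(2) this this] have "snd (form_of T) 0 0 = 0" by simp
  moreover have "fst p \<in> Domain T" using p by (metis DomainI prod.collapse)
  \<comment> \<open>The constant sequence also ensures that the limit defining the value is not
    vacuous.\<close>
  ultimately have const: "form_conv (form_of T) (\<lambda>n. fst p) (fst p)"
    by (simp add: form_conv_def fst_form_of)
  thus ?A by (auto simp: closed_form_def form_closure_def)
  have lift: "\<exists>X. (\<forall>n. X n \<in> T) \<and> x = (\<lambda>n. fst (X n))" if "form_conv (form_of T) x (fst p)" for x
  proof -
    have "\<forall>n. \<exists>x'. (x n, x') \<in> T" using that by (auto simp: form_conv_def fst_form_of Domain_iff)
    then obtain x' where "\<And>n. (x n, x' n) \<in> T" by metis
    thus ?thesis by (intro exI[of _ "\<lambda>n. (x n, x' n)"]) simp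
  qed
  have lim: "(\<lambda>n. snd (form_of T) (x n) (y n)) \<longlonglongrightarrow> cinner (snd p) (fst p)"
    if x: "form_conv (form_of T) x (fst p)" and y: "form_conv (form_of T) y (fst p)" for x y
  proof -
    obtain X where X: "\<And>n. X n \<in> T" "x = (\<lambda>n. fst (X n))" using lift[OF x] by blast
    obtain Y where Y: "\<And>n. Y n \<in> T" "y = (\<lambda>n. fst (Y n))" using lift[OF y] by blast
    have "(\<lambda>n. energy c (X n) (Y n)) \<longlonglongrightarrow> energy c p p"
      using form_conv_energy[OF T X(1) p x[unfolded X(2)]] form_conv_energy[OF T Y(1) p y[unfolded Y(2)]]
      by (rule tendsto_energy[OF T X(1) Y(1) p p])
    moreover have "x \<longlonglongrightarrow> fst p" "y \<longlonglongrightarrow> fst p" using x y by (auto simp: form_conv_def)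
    ultimately have "(\<lambda>n. energy c (X n) (Y n) + of_real c * cinner (x n) (y n))
        \<longlonglongrightarrow> energy c p p + of_real c * cinner (fst p) (fst p)"
      by (intro tendsto_intros)
    moreover have "energy c (X n) (Y n) + of_real c * cinner (x n) (y n) = snd (form_of T) (x n) (y n)" for n
      using form_of_symmetric[OF T(2) X(1)[of n] Y(1)[of n]]
      by (simp add: energy_def cinner_linear X(2) Y(2))
    moreover have "energy c p p + of_real c * cinner (fst p) (fst p) = cinner (snd p) (fst p)"
      by (simp add: energy_def cinner_linear)
    ultimately show ?thesis by simp
  qed
  show ?B unfolding closed_form_def form_closure_def snd_conv
    by (rule the_equality) (use lim const LIMSEQ_unique in blast)+
qed

section \<open>Extremality as an approximation property\<close>

lemma extremalD:
  assumes ext: "extremal S H c" and p: "p \<in> H"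
  shows "q \<in> S \<Longrightarrow> 0 \<le> Re (energy c (p - q) (p - q))"
    and "e > 0 \<Longrightarrow> \<exists>q\<in>S. Re (energy c (p - q) (p - q)) < e"
proof -
  define F where "F q = ereal (Re (energy c (p - q) (p - q)))" for q
  have "(\<lambda>(h, h'). ereal (Re (cinner (snd p - h' - c *\<^sub>R (fst p - h)) (fst p - h)))) = F"
    by (auto simp: F_def energy_def fun_eq_iff)
  moreover have "Inf ((\<lambda>(h, h'). ereal (Re (cinner (snd p - h' - c *\<^sub>R (fst p - h)) (fst p - h)))) ` S) = 0"
    using p by (intro ext[unfolded extremal_def, rule_format]) simp
  ultimately have I: "Inf (F ` S) = 0" by simp
  show "0 \<le> Re (energy c (p - q) (p - q))" if "q \<in> S"
    using INF_lower[OF that, of F] I by (simp add: F_def zero_ereal_def)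
  show "\<exists>q\<in>S. Re (energy c (p - q) (p - q)) < e" if "e > 0"
    using I that INF_less_iff[of F S "ereal e"] by (simp add: F_def zero_ereal_def)
qed

lemma extremalI:
  assumes nonneg: "\<And>p q. p \<in> H \<Longrightarrow> q \<in> S \<Longrightarrow> 0 \<le> Re (energy c (p - q) (p - q))"
    and small: "\<And>p e. p \<in> H \<Longrightarrow> e > 0 \<Longrightarrow> \<exists>q\<in>S. Re (energy c (p - q) (p - q)) < e"
  shows "extremal S H c"
  unfolding extremal_def
proof (intro allI impI)
  fix f f' assume p: "(f, f') \<in> H"
  define F where "F q = ereal (Re (energy c ((f, f') - q) ((f, f') - q)))" for q
  have "(\<lambda>(h, h'). ereal (Re (cinner (f' - h' - c *\<^sub>R (f - h)) (f - h)))) = F"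
    by (auto simp: F_def energy_def fun_eq_iff)
  moreover have "0 \<le> Inf (F ` S)"
    using nonneg[OF p] by (intro INF_greatest) (simp add: F_def zero_ereal_def)
  moreover have "Inf (F ` S) \<le> 0"
  proof (rule ereal_le_epsilon2)
    fix e :: real assume "e > 0"
    then obtain q where "q \<in> S" "Re (energy c ((f, f') - q) ((f, f') - q)) < e" using small[OF p] by blast
    thus "Inf (F ` S) \<le> 0 + ereal e" by (intro INF_lower2[of q]) (auto simp: F_def)
  qed
  ultimately show "Inf ((\<lambda>(h, h'). ereal (Re (cinner (f' - h' - c *\<^sub>R (f - h)) (f - h)))) ` S) = 0"
    by simp
qed

section \<open>The companion relation and the maps behind the Friedrichs and Krein forms\<close>

lemma Domain_companion: "Domain (companion S c Q) = Q ` Domain S"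
  by (auto simp: companion_def)

lemma csubspace_rep_graph:
  assumes S: "csubspace S" and Q: "representing_map S c Q"
  shows "csubspace (rep_graph S Q)"
proof -
  note D = csubspaceD[OF csubspace_Domain[OF S]]
  have add: "Q (x + y) = Q x + Q y" if "x \<in> Domain S" "y \<in> Domain S" for x y
    using Q that by (simp add: representing_map_def)
  have scale: "Q (a *\<^sub>C x) = a *\<^sub>C Q x" if "x \<in> Domain S" for a x
    using Q that by (simp add: representing_map_def)
  have "Q 0 = 0" using add[OF D(1) D(1)] by simp
  thus ?thesis
    using D(1-3) unfolding csubspace_def rep_graph_def
    by (auto simp: add scale zero_prod_def)
qed

lemma csubspace_companion:
  assumes S: "csubspace S" and Q: "representing_map S c Q"
  shows "csubspace (companion S c Q)"
proof -
  have S1: "(0, 0) \<in> S" "\<And>f f' g g'. (f, f') \<in> S \<Longrightarrow> (g, g') \<in> S \<Longrightarrow> (f + g, f' + g') \<in> S"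
    "\<And>a f f'. (f, f') \<in> S \<Longrightarrow> (a *\<^sub>C f, a *\<^sub>C f') \<in> S"
    using S unfolding lin_rel_iff_csubspace[symmetric] lin_rel_def by blast+
  have add: "Q (x + y) = Q x + Q y" if "x \<in> Domain S" "y \<in> Domain S" for x y
    using Q that by (simp add: representing_map_def)
  have scale: "Q (a *\<^sub>C x) = a *\<^sub>C Q x" if "x \<in> Domain S" for a x
    using Q that by (simp add: representing_map_def)
  have "Q 0 = 0" using add[of 0 0] S1(1) by auto
  hence zero: "(0, 0) \<in> companion S c Q" using S1(1) unfolding companion_def by force
  have "p + q \<in> companion S c Q" if "p \<in> companion S c Q" "q \<in> companion S c Q" for p q
  proof -
    obtain f f' g g' where fg: "(f, f') \<in> S" "(g, g') \<in> S" "p = (Q f, f' - c *\<^sub>R f)" "q = (Q g, g' - c *\<^sub>R g)"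
      using \<open>p \<in> _\<close> \<open>q \<in> _\<close> unfolding companion_def by blast
    hence "p + q = (Q (f + g), (f' + g') - c *\<^sub>R (f + g))"
      by (auto simp: add Domain.intros algebra_simps)
    thus ?thesis using S1(2)[OF fg(1,2)] unfolding companion_def by blast
  qed
  moreover have "a *\<^sub>C p \<in> companion S c Q" if "p \<in> companion S c Q" for a p
  proof -
    obtain f f' where f: "(f, f') \<in> S" "p = (Q f, f' - c *\<^sub>R f)"
      using \<open>p \<in> _\<close> unfolding companion_def by blast
    have "a *\<^sub>C (f' - c *\<^sub>R f) = a *\<^sub>C f' - c *\<^sub>R (a *\<^sub>C f)"
      using scaleC_add_right[of a f' "- (c *\<^sub>R f)"]
      by (simp add: scaleC_minus_right scaleR_scaleC scaleC_scaleC mult.commute)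
    hence "a *\<^sub>C p = (Q (a *\<^sub>C f), a *\<^sub>C f' - c *\<^sub>R (a *\<^sub>C f))"
      using f by (auto simp: scale Domain.intros)
    thus ?thesis using S1(3)[OF f(1)] unfolding companion_def by blast
  qed
  ultimately show ?thesis using zero by (simp add: csubspace_def zero_prod_def)
qed

text \<open>The adjoint condition, tested on the pair that \<open>p\<close> contributes to the
  companion relation. It evaluates energies of elements of \<open>S\<close> against elements of an
  extension.\<close>

lemma energy_companion:
  assumes "p \<in> S" and "(fst q, k) \<in> adj (companion S c Q)"
  shows "energy c p q = cinner (Q (fst p)) k"
proof -
  have "(Q (fst p), snd p - c *\<^sub>R fst p) \<in> companion S c Q"
    using assms(1) unfolding companion_def mem_Collect_eq
    by (intro exI[of _ "fst p"] exI[of _ "snd p"]) simp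
  from adjD[OF assms(2) this] show ?thesis by (simp add: energy_def)
qed

lemma rep_graph_subset_adj_companion:
  assumes Q: "representing_map S c Q"
  shows "rep_graph S Q \<subseteq> adj (companion S c Q)"
proof -
  have "cinner (\<phi>' - c *\<^sub>R \<phi>) \<psi> = cinner (Q \<phi>) (Q \<psi>)" if "(\<phi>, \<phi>') \<in> S" "\<psi> \<in> Domain S" for \<phi> \<phi>' \<psi>
    using Q that by (simp add: representing_map_def cinner_linear)
  thus ?thesis by (auto simp: rep_graph_def companion_def adj_def)
qed

lemma form_rep_friedrichs:
  "form_rep (friedrichs S c Q) c
    {(f, g). (f, g) \<in> adj (adj (rep_graph S Q)) \<and> g \<in> Domain (adj (rep_graph S Q))}"
  unfolding friedrichs_def by (intro form_rep_shift_relprod csubspace_adj order_refl)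

lemma form_rep_krein:
  "form_rep (krein S c Q) c
    {(f, g). (f, g) \<in> adj (companion S c Q) \<and> g \<in> Domain (adj (adj (companion S c Q)))}"
  unfolding krein_def by (intro form_rep_shift_relprod csubspace_adj subset_adj_adj)

text \<open>The operator part of the adjoint of the companion relation.\<close>

definition krein_map :: "('a::complex_inner \<times> 'a) set \<Rightarrow> real \<Rightarrow> ('a \<Rightarrow> 'b::complex_inner) \<Rightarrow> ('a \<times> 'b) set" where
  "krein_map S c Q = {(f, g). (f, g) \<in> adj (companion S c Q) \<and> g \<in> closure (Q ` Domain S)}"

lemma closed_krein_map: "closed (krein_map S c Q)"
proof -
  have "krein_map S c Q = adj (companion S c Q) \<inter> snd -` closure (Q ` Domain S)"
    by (auto simp: krein_map_def)
  thus ?thesis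
    by (simp add: closed_Int closed_adj continuous_closed_vimage continuous_intros)
qed

lemma krein_map_unique:
  assumes "(f, k) \<in> krein_map S c Q" and "(f, l) \<in> krein_map S c Q"
    and S: "csubspace S" and Q: "representing_map S c Q"
  shows "k = l"
proof -
  have "k - l \<in> closure (Domain (companion S c Q))"
    using assms(1,2) csubspaceD(4)[OF csubspace_closure[OF csubspace_Domain[OF csubspace_companion[OF S Q]]]]
    by (simp add: krein_map_def Domain_companion)
  moreover have "(0, k - l) \<in> adj (companion S c Q)"
    using assms(1,2) csubspaceD(4)[OF csubspace_adj, of "(f, k)" _ "(f, l)"] by (simp add: krein_map_def)
  ultimately show ?thesis using mem_adj_closure_Domain_zero by fastforce
qed

lemma csubspace_krein_map:
  assumes S: "csubspace S" and Q: "representing_map S c Q"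
  shows "csubspace (krein_map S c Q)"
proof -
  have "krein_map S c Q = {p. p \<in> adj (companion S c Q) \<and> snd p \<in> closure (Domain (companion S c Q))}"
    by (auto simp: krein_map_def Domain_companion)
  thus ?thesis
    using csubspaceD(1-3)[OF csubspace_closure[OF csubspace_Domain[OF csubspace_companion[OF S Q]]]]
      csubspaceD(1-3)[OF csubspace_adj]
    by (auto simp: csubspace_def)
qed

text \<open>The left side is the closure of the relation in \<open>form_rep_krein\<close>, so
  \<open>krein_map\<close> is the closed graph from which the Krein form is read off.\<close>

lemma closure_krein_core:
  fixes S :: "('a::chilbert_space \<times> 'a) set" and Q :: "'a \<Rightarrow> 'b::chilbert_space"
  assumes S: "csubspace S" and Q: "representing_map S c Q"
  shows "closure {(f, g). (f, g) \<in> adj (companion S c Q) \<and> g \<in> Domain (adj (adj (companion S c Q)))}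
    = krein_map S c Q"
  unfolding krein_map_def adj_core[OF csubspace_companion[OF S Q]] Domain_companion ..

lemma rep_graph_subset_krein_map:
  assumes "representing_map S c Q"
  shows "rep_graph S Q \<subseteq> krein_map S c Q"
  using rep_graph_subset_adj_companion[OF assms] closure_subset[of "Q ` Domain S"]
  by (auto simp: krein_map_def rep_graph_def)

lemma energy_on_S:
  assumes Q: "representing_map S c Q" and pq: "p \<in> S" "q \<in> S"
  shows "energy c p q = cinner (Q (fst p)) (Q (fst q))"
proof (rule energy_companion[OF pq(1)])
  have "fst q \<in> Domain S" using pq(2) by (metis DomainI prod.collapse)
  thus "(fst q, Q (fst q)) \<in> adj (companion S c Q)"
    using rep_graph_subset_adj_companion[OF Q] by (auto simp: rep_graph_def)
qed

lemma representing_map_diff: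
  assumes S: "csubspace S" and Q: "representing_map S c Q" and pq: "p \<in> S" "q \<in> S"
  shows "Q (fst p - fst q) = Q (fst p) - Q (fst q)"
proof -
  have "(x, Q x) \<in> rep_graph S Q" if "x \<in> fst ` S" for x
    using that unfolding Domain_fst[symmetric] by (auto simp: rep_graph_def)
  hence "(fst p, Q (fst p)) - (fst q, Q (fst q)) \<in> rep_graph S Q"
    using pq by (intro csubspaceD(4)[OF csubspace_rep_graph[OF S Q]]) blast+
  thus ?thesis by (simp add: rep_graph_def)
qed

section \<open>Forms of extremal extensions\<close>

text \<open>Extremality supplies a sequence in \<open>S\<close> tending to \<open>p\<close> in
  energy. On \<open>S\<close> the energy is the inner product of \<open>Q\<close>-values, so these
  are Cauchy; their limit \<open>k\<close> is the image of \<open>fst p\<close>.\<close>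

lemma extremal_approx:
  fixes S H :: "('a::chilbert_space \<times> 'a) set" and Q :: "'a \<Rightarrow> 'b::chilbert_space"
  assumes S: "csubspace S" and Q: "representing_map S c Q"
    and H: "csubspace H" "H \<subseteq> adj H" "bounded_below_by H c"
    and SH: "S \<subseteq> H" and ext: "extremal S H c" and p: "p \<in> H"
  obtains h k where "\<And>n. h n \<in> S" "(\<lambda>n. Re (energy c (h n - p) (h n - p))) \<longlonglongrightarrow> 0"
    "(\<lambda>n. Q (fst (h n))) \<longlonglongrightarrow> k" "(fst p, k) \<in> krein_map S c Q"
proof -
  have "\<forall>n. \<exists>q\<in>S. Re (energy c (p - q) (p - q)) < 1 / real (Suc n)"
    by (intro allI extremalD(2)[OF ext p]) simp
  then obtain h where h: "\<And>n. h n \<in> S" "\<And>n. Re (energy c (p - h n) (p - h n)) < 1 / real (Suc n)"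
    by metis
  have hH: "h n \<in> H" for n using h(1) SH by blast
  define z where "z n = h n - p" for n
  have z: "z n \<in> H" for n unfolding z_def by (rule csubspaceD(4)[OF H(1) hH p])
  have zlt: "Re (energy c (z n) (z n)) < 1 / real (Suc n)" for n
    using h(2)[of n] by (simp add: z_def energy_linear)
  have lim0: "(\<lambda>n. Re (energy c (z n) (z n))) \<longlonglongrightarrow> 0"
  proof (rule tendsto_sandwich[OF _ _ tendsto_const LIMSEQ_Suc[OF lim_1_over_n]])
    show "\<forall>\<^sub>F n in sequentially. 0 \<le> Re (energy c (z n) (z n))"
      using energy_nonneg[OF H(3) z] by simp
    show "\<forall>\<^sub>F n in sequentially. Re (energy c (z n) (z n)) \<le> 1 / real (Suc n)"
      using zlt by (intro always_eventually allI less_imp_le)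
  qed
  \<comment> \<open>\<open>z n - z m\<close> equals \<open>h n - h m\<close>, whose energy is the
    squared norm on the left. The bound is the parallelogram law without the nonnegative energy of
    \<open>z n + z m\<close>.\<close>
  have diff: "(norm (Q (fst (h n)) - Q (fst (h m))))\<^sup>2
      \<le> 2 * Re (energy c (z n) (z n)) + 2 * Re (energy c (z m) (z m))" for n m
  proof -
    have "h n - h m \<in> S" by (rule csubspaceD(4)[OF S h(1) h(1)])
    from energy_on_S[OF Q this this]
    have "(norm (Q (fst (h n)) - Q (fst (h m))))\<^sup>2 = Re (energy c (z n - z m) (z n - z m))"
      by (simp add: representing_map_diff[OF S Q h(1) h(1)] norm_sq_cinner z_def)
    moreover have "Re (energy c (z n - z m) (z n - z m)) + Re (energy c (z n + z m) (z n + z m))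
        = 2 * Re (energy c (z n) (z n)) + 2 * Re (energy c (z m) (z m))"
      by (simp add: energy_linear)
    moreover have "0 \<le> Re (energy c (z n + z m) (z n + z m))"
      by (intro energy_nonneg[OF H(3)] csubspaceD(2)[OF H(1)] z)
    ultimately show ?thesis by linarith
  qed
  have "Cauchy (\<lambda>n. Q (fst (h n)))"
  proof (rule CauchyI)
    fix e :: real assume e: "e > 0"
    have "\<forall>\<^sub>F n in sequentially. Re (energy c (z n) (z n)) < e\<^sup>2 / 4"
      using e by (intro order_tendstoD(2)[OF lim0]) simp
    then obtain N where N: "\<And>n. n \<ge> N \<Longrightarrow> Re (energy c (z n) (z n)) < e\<^sup>2 / 4"
      by (auto simp: eventually_sequentially)
    show "\<exists>N. \<forall>m\<ge>N. \<forall>n\<ge>N. norm (Q (fst (h m)) - Q (fst (h n))) < e"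
    proof (intro exI allI impI)
      fix m n assume "m \<ge> N" "n \<ge> N"
      hence "(norm (Q (fst (h m)) - Q (fst (h n))))\<^sup>2 < e\<^sup>2"
        using N[of m] N[of n] diff[of m n] by linarith
      thus "norm (Q (fst (h m)) - Q (fst (h n))) < e" using e by (simp add: power_less_imp_less_base)
    qed
  qed
  then obtain k where k: "(\<lambda>n. Q (fst (h n))) \<longlonglongrightarrow> k" using Cauchy_convergent convergent_def by blast
  have "fst (h n) \<in> Domain S" for n using h(1)[of n] by (metis DomainI prod.collapse)
  hence "k \<in> closure (Q ` Domain S)" using k unfolding closure_sequential
    by (intro exI[of _ "\<lambda>n. Q (fst (h n))"]) simp
  \<comment> \<open>The energy against a fixed pair of \<open>S\<close> is followed along
    \<open>h\<close> in two ways: by convergence in energy and by convergence of the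
    \<open>Q\<close>-values.\<close>
  moreover have "cinner (\<phi>' - c *\<^sub>R \<phi>) (fst p) = cinner (Q \<phi>) k" if \<phi>: "(\<phi>, \<phi>') \<in> S" for \<phi> \<phi>'
  proof -
    have \<phi>H: "(\<phi>, \<phi>') \<in> H" using \<phi> SH by blast
    have "(\<lambda>n. energy c (\<phi>, \<phi>') (h n)) \<longlonglongrightarrow> energy c (\<phi>, \<phi>') p"
      by (rule tendsto_energy[OF H \<phi>H hH \<phi>H p])
        (use lim0 in \<open>simp_all add: energy_def z_def\<close>)
    moreover have "(\<lambda>n. energy c (\<phi>, \<phi>') (h n)) \<longlonglongrightarrow> cinner (Q \<phi>) k"
      unfolding energy_on_S[OF Q \<phi> h(1)] fst_conv by (intro tendsto_intros k)
    ultimately have "energy c (\<phi>, \<phi>') p = cinner (Q \<phi>) k" by (rule LIMSEQ_unique)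
    thus ?thesis by (simp add: energy_def)
  qed
  ultimately have "(fst p, k) \<in> krein_map S c Q"
    by (auto simp: krein_map_def adj_def companion_def)
  with that[OF h(1) lim0[unfolded z_def] k] show thesis .
qed

text \<open>An extremal extension has its form represented in the same space as \<open>S\<close>, by a restriction of the
  map representing the form of the Krein extension.\<close>

lemma form_rep_extremal:
  fixes S H :: "('a::chilbert_space \<times> 'a) set" and Q :: "'a \<Rightarrow> 'b::chilbert_space"
  assumes S: "csubspace S" and Q: "representing_map S c Q"
    and H: "csubspace H" "H \<subseteq> adj H" "bounded_below_by H c"
    and SH: "S \<subseteq> H" and ext: "extremal S H c"
  shows "form_rep H c {(f, g). (f, g) \<in> krein_map S c Q \<and> f \<in> Domain H}"
  unfolding form_rep_def
proof (intro conjI allI impI)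
  have "{(f, g). (f, g) \<in> krein_map S c Q \<and> f \<in> Domain H} = {p. p \<in> krein_map S c Q \<and> fst p \<in> Domain H}"
    by auto
  thus "csubspace {(f, g). (f, g) \<in> krein_map S c Q \<and> f \<in> Domain H}"
    using csubspaceD(1-3)[OF csubspace_krein_map[OF S Q]] csubspaceD(1-3)[OF csubspace_Domain[OF H(1)]]
    by (auto simp: csubspace_def)
  have "\<exists>k. (f, k) \<in> krein_map S c Q" if f: "(f, f') \<in> H" for f f'
    by (rule extremal_approx[OF S Q H SH ext f]) auto
  thus "Domain {(f, g). (f, g) \<in> krein_map S c Q \<and> f \<in> Domain H} = Domain H" by blast
next
  fix f f' g e k
  assume f: "(f, f') \<in> H" and g: "(f, g) \<in> {(f, g). (f, g) \<in> krein_map S c Q \<and> f \<in> Domain H}"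
    and k: "(e, k) \<in> {(f, g). (f, g) \<in> krein_map S c Q \<and> f \<in> Domain H}"
  obtain e' where e: "(e, e') \<in> H" using k by blast
  obtain h k' where h: "\<And>n. h n \<in> S" "(\<lambda>n. Re (energy c (h n - (e, e')) (h n - (e, e')))) \<longlonglongrightarrow> 0"
    "(\<lambda>n. Q (fst (h n))) \<longlonglongrightarrow> k'" and "(e, k') \<in> krein_map S c Q"
    using extremal_approx[OF S Q H SH ext e] unfolding fst_conv by blast
  \<comment> \<open>The image \<open>k\<close> is given while \<open>k'\<close> arises as a limit;
    single-valuedness of \<open>krein_map\<close> identifies them.\<close>
  hence "k' = k" using krein_map_unique[OF _ _ S Q] k by blast
  have hH: "h n \<in> H" for n using h(1) SH by blast
  have "(\<lambda>n. energy c (f, f') (h n)) \<longlonglongrightarrow> energy c (f, f') (e, e')"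
    by (rule tendsto_energy[OF H f hH f e]) (use h(2) in \<open>simp_all add: energy_def\<close>)
  \<comment> \<open>The companion relation evaluates the energy of \<open>h n\<close> against
    \<open>(f, f')\<close>; symmetry of \<open>H\<close> exchanges the arguments.\<close>
  moreover have "energy c (f, f') (h n) = cinner g (Q (fst (h n)))" for n
    using energy_companion[OF h(1)[of n], of "(f, f')" g c Q] g energy_commute[OF H(2) f hH, of c n]
      cinner_commute[of g] by (simp add: krein_map_def)
  moreover have "(\<lambda>n. cinner g (Q (fst (h n)))) \<longlonglongrightarrow> cinner g k"
    using h(3) \<open>k' = k\<close> by (intro tendsto_intros) simp
  ultimately have "energy c (f, f') (e, e') = cinner g k" by (simp add: LIMSEQ_unique)
  thus "cinner f' e = of_real c * cinner f e + cinner g k"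
    by (simp add: energy_def cinner_linear algebra_simps)
qed

section \<open>Equivalence of extremality and the form inclusions\<close>

text \<open>The zero pair of \<open>S\<close> competes in the infimum, so the energy of each element
  of \<open>H\<close> is nonnegative; symmetry makes \<open>cinner f' f\<close> real.\<close>

lemma extremal_imp_bounded_below:
  assumes S: "csubspace S" and H: "H \<subseteq> adj H" and ext: "extremal S H c"
  shows "bounded_below_by H c"
  unfolding bounded_below_by_def
proof (intro allI impI)
  fix f f' assume f: "(f, f') \<in> H"
  have "cinner f' f = cinner f f'" using f H by (auto dest: adjD)
  hence "cinner f' f \<in> \<real>" using cinner_commute[of f' f] by (simp add: Reals_cnj_iff)
  moreover have "0 \<le> Re (energy c ((f, f') - 0) ((f, f') - 0))"
    by (rule extremalD(1)[OF ext f csubspaceD(1)[OF S]])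
  ultimately show "cinner f' f \<in> \<real> \<and> c * (norm f)\<^sup>2 \<le> Re (cinner f' f)"
    by (simp add: energy_def cinner_linear cinner_self)
qed

lemma extremal_of_form_ext_krein:
  fixes S H :: "('a::chilbert_space \<times> 'a) set" and Q :: "'a \<Rightarrow> 'b::chilbert_space"
  assumes S: "csubspace S" and Q: "representing_map S c Q"
    and H: "csubspace H" "H \<subseteq> adj H" "bounded_below_by H c"
    and SH: "S \<subseteq> H" and ext: "form_ext (closed_form H) (closed_form (krein S c Q))"
  shows "extremal S H c"
proof (rule extremalI)
  fix p q assume "p \<in> H" "q \<in> S"
  thus "0 \<le> Re (energy c (p - q) (p - q))"
    using SH by (intro energy_nonneg[OF H(3)] csubspaceD(4)[OF H(1)]) auto
next
  fix p and e :: real assume p: "p \<in> H" and e: "e > 0"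
  note rep = form_rep_krein[of S c Q]
  note core = closure_krein_core[OF S Q]
  have "fst p \<in> fst (closed_form (krein S c Q))"
    using ext closed_form_on_domain(1)[OF H p] by (auto simp: form_ext_def)
  then obtain g where g: "(fst p, g) \<in> krein_map S c Q"
    unfolding fst_closed_form_rep[OF rep] core by blast
  have "cinner (snd p) (fst p) = of_real c * cinner (fst p) (fst p) + cinner g g"
    using ext closed_form_on_domain[OF H p] snd_closed_form_rep[OF rep, unfolded core, OF g g]
    by (auto simp: form_ext_def)
  hence pp: "energy c p p = cinner g g" by (simp add: energy_def cinner_linear)
  \<comment> \<open>Membership of \<open>g\<close> in the closure of the range of \<open>Q\<close>
    is the part of \<open>krein_map\<close> that yields approximants from \<open>S\<close>.\<close>
  obtain u where u: "\<And>n. u n \<in> Q ` Domain S" "u \<longlonglongrightarrow> g"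
    using g unfolding krein_map_def closure_sequential by blast
  have "\<forall>n. \<exists>h. h \<in> S \<and> u n = Q (fst h)" using u(1) by fastforce
  then obtain h where h: "\<And>n. h n \<in> S" "\<And>n. u n = Q (fst (h n))" by metis
  have hp: "energy c (h n) p = cinner (u n) g" for n
    using energy_companion[OF h(1)[of n], of p g c Q] g by (simp add: krein_map_def h(2))
  hence ph: "energy c p (h n) = cinner g (u n)" for n
    using energy_commute[OF H(2) p subsetD[OF SH h(1)]] cinner_commute[of g "u n"] by simp
  \<comment> \<open>The right side is the squared norm of \<open>g - u n\<close>.\<close>
  have "energy c (p - h n) (p - h n) = cinner g g - cinner g (u n) - (cinner (u n) g - cinner (u n) (u n))" for n
    by (simp add: energy_linear pp hp ph energy_on_S[OF Q h(1) h(1)] h(2)[symmetric])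
  moreover have "(\<lambda>n. Re (cinner g g - cinner g (u n) - (cinner (u n) g - cinner (u n) (u n))))
      \<longlonglongrightarrow> Re (cinner g g - cinner g g - (cinner g g - cinner g g))"
    by (intro tendsto_intros u)
  ultimately have "(\<lambda>n. Re (energy c (p - h n) (p - h n))) \<longlonglongrightarrow> 0" by simp
  from order_tendstoD(2)[OF this e] obtain n where "Re (energy c (p - h n) (p - h n)) < e"
    by (auto simp: eventually_sequentially)
  thus "\<exists>q\<in>S. Re (energy c (p - q) (p - q)) < e" using h(1) by blast
qed

theorem theorem7p5:
  fixes S H :: "('a::chilbert_space \<times> 'a) set"
    and Q :: "'a \<Rightarrow> 'b::chilbert_space"
    and \<gamma> c :: real
  assumes "lin_rel S"
    and "has_lower_bound S \<gamma>"
    and "c \<le> \<gamma>"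
    and "representing_map S c Q"
  shows "(selfadjoint H \<and> S \<subseteq> H \<and> semibounded H \<and> bounded_below_by H c \<and>
          form_ext (closed_form (friedrichs S c Q)) (closed_form H) \<and>
          form_ext (closed_form H) (closed_form (krein S c Q)))
     \<longleftrightarrow> (selfadjoint H \<and> S \<subseteq> H \<and> semibounded H \<and> extremal S H c)"
    (is "?i \<longleftrightarrow> ?ii")
proof -
  have S: "csubspace S" using assms(1) by (simp add: lin_rel_iff_csubspace)
  note Q = assms(4)
  \<comment> \<open>A selfadjoint relation is linear because every adjoint is.\<close>
  have sa: "csubspace H" "H \<subseteq> adj H" if "selfadjoint H"
    using that csubspace_adj[of H] by (simp_all add: selfadjoint_def)
  show ?thesis
  proof
    assume ?i
    thus ?ii using extremal_of_form_ext_krein[OF S Q sa] by blast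
  next
    assume ii: ?ii
    hence H: "csubspace H" "H \<subseteq> adj H" and SH: "S \<subseteq> H" and ext: "extremal S H c" using sa by blast+
    have bd: "bounded_below_by H c" by (rule extremal_imp_bounded_below[OF S H(2) ext])
    note rep = form_rep_extremal[OF S Q H bd SH ext]
    let ?R = "{(f, g). (f, g) \<in> krein_map S c Q \<and> f \<in> Domain H}"
    let ?F = "{(f, g). (f, g) \<in> adj (adj (rep_graph S Q)) \<and> g \<in> Domain (adj (rep_graph S Q))}"
    \<comment> \<open>The relation representing the Friedrichs form lies in the closure of the graph
      of \<open>Q\<close>, and that graph lies in the relation \<open>?R\<close> representing the
      form of \<open>H\<close>.\<close>
    have "?F \<subseteq> closure (rep_graph S Q)"
      using adj_adj[OF csubspace_rep_graph[OF S Q]] by blast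
    moreover have "rep_graph S Q \<subseteq> ?R"
      using rep_graph_subset_krein_map[OF Q] SH by (auto simp: rep_graph_def)
    ultimately have "closure ?F \<subseteq> closure ?R"
      by (meson closed_closure closure_minimal closure_mono order_trans)
    hence "form_ext (closed_form (friedrichs S c Q)) (closed_form H)"
      by (rule form_ext_rep[OF form_rep_friedrichs rep])
    \<comment> \<open>\<open>?R\<close> is a restriction of the closed graph
      \<open>krein_map\<close>, which represents the Krein form.\<close>
    moreover have "closure ?R \<subseteq> krein_map S c Q"
      by (intro closure_minimal closed_krein_map) auto
    hence "form_ext (closed_form H) (closed_form (krein S c Q))"
      by (intro form_ext_rep[OF rep form_rep_krein]) (simp only: closure_krein_core[OF S Q])
    ultimately show ?i using ii bd by blast
  qed
qed

end
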